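(* Let $N \in B(\mathcal{H})$ be a normal operator with finite spectrum and diagonal $(d_n)$, where $d_n = \langle N e_n, e_n \rangle$, and let $X$ be the set of vertices of the convex hull of the essential spectrum $\sigma_{\mathrm{ess}}(N)$. Then $(d_n) \in \mathrm{Lim}^1(X)$ if and only if $\sigma_{\mathrm{ess}}(N) = X$ and $N$ is diagonalizable by a unitary which is a Hilbert--Schmidt perturbation of the identity.
   Context: $\mathcal{H}$ is a separable infinite-dimensional complex Hilbert space with a fixed orthonormal basis $\{e_n\}_{n=1}^\infty$. An operator is diagonal if it is diagonal with respect to this fixed basis. "$N$ is diagonalizable by a unitary which is a Hilbert--Schmidt perturbation of the identity" means that there is a unitary $U = I + K$ with $K$ Hilbert--Schmidt such that $UNU^*$ is diagonal with respect to the fixed basis $\{e_n\}$. Vertices of the convex hull are its extreme points. For a finite set $X \subseteq \mathbb{C}$, $$\mathrm{Lim}^1(X) := \Big\{ (d_n) \in \ell^\infty : \sum_{n=1}^\infty \operatorname{dist}(d_n, X) < \infty \Big\}.$$ *)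

theory Defs
  imports "HOL-Analysis.Analysis"
begin

text \<open>
  Complex inner product spaces are real inner product spaces with a compatible complex structure,
  so that norm, topology and completeness are those of the library. The complex inner product is
  linear in its first argument.
\<close>

class complex_inner = real_inner +
  fixes scaleC :: "complex \<Rightarrow> 'a \<Rightarrow> 'a" (infixr "*\<^sub>C" 75)
    and cinner :: "'a \<Rightarrow> 'a \<Rightarrow> complex"
  assumes scaleC_add_right: "c *\<^sub>C (x + y) = c *\<^sub>C x + c *\<^sub>C y"
    and scaleC_add_left: "(c + d) *\<^sub>C x = c *\<^sub>C x + d *\<^sub>C x"
    and scaleC_scaleC: "c *\<^sub>C d *\<^sub>C x = (c * d) *\<^sub>C x"
    and scaleC_of_real: "complex_of_real r *\<^sub>C x = scaleR r x"
    and cinner_commute: "cinner x y = cnj (cinner y x)"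
    and cinner_add_left: "cinner (x + y) z = cinner x z + cinner y z"
    and cinner_scaleC_left: "cinner (c *\<^sub>C x) y = c * cinner x y"
    and Re_cinner: "Re (cinner x y) = inner x y"

class chilbert_space = complex_inner + complete_space

lemma vector_space_scaleC: "vector_space (scaleC :: complex \<Rightarrow> 'a \<Rightarrow> 'a::complex_inner)"
proof
  fix x :: 'a
  show "1 *\<^sub>C x = x"
    using scaleC_of_real[of 1 x] by simp
qed (simp_all add: scaleC_add_right scaleC_add_left scaleC_scaleC)

lemma cinner_self: "cinner x x = complex_of_real ((norm x)\<^sup>2)" for x :: "'a::complex_inner"
proof (rule complex_eqI)
  show "Re (cinner x x) = Re (complex_of_real ((norm x)\<^sup>2))"
    by (simp add: Re_cinner power2_norm_eq_inner)
  have "Im (cinner x x) = Im (cnj (cinner x x))"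
    by (rule arg_cong[OF cinner_commute])
  then show "Im (cinner x x) = Im (complex_of_real ((norm x)\<^sup>2))"
    by simp
qed

text \<open>
  An orthonormal basis indexed by the natural numbers (starting at 0): an orthonormal sequence with
  dense complex linear span. Its existence makes the space separable and infinite-dimensional.
\<close>

definition orthonormal_basis :: "(nat \<Rightarrow> 'a::complex_inner) \<Rightarrow> bool" where
  "orthonormal_basis e \<longleftrightarrow>
     (\<forall>i j. cinner (e i) (e j) = (if i = j then 1 else 0)) \<and>
     closure (module.span scaleC (range e)) = UNIV"

definition bounded_clinear :: "('a::complex_inner \<Rightarrow> 'a) \<Rightarrow> bool" where
  "bounded_clinear T \<longleftrightarrow> bounded_linear T \<and> (\<forall>c x. T (c *\<^sub>C x) = c *\<^sub>C T x)"

text \<open>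
  On a Hilbert space every bounded operator has exactly one adjoint, so the choice is determined.
\<close>

definition cadjoint :: "('a::complex_inner \<Rightarrow> 'a) \<Rightarrow> 'a \<Rightarrow> 'a" where
  "cadjoint T = (SOME S. \<forall>x y. cinner (T x) y = cinner x (S y))"

definition normal_op :: "('a::complex_inner \<Rightarrow> 'a) \<Rightarrow> bool" where
  "normal_op T \<longleftrightarrow> bounded_clinear T \<and> T \<circ> cadjoint T = cadjoint T \<circ> T"

definition unitary_op :: "('a::complex_inner \<Rightarrow> 'a) \<Rightarrow> bool" where
  "unitary_op U \<longleftrightarrow> bounded_clinear U \<and> cadjoint U \<circ> U = id \<and> U \<circ> cadjoint U = id"

definition compact_op :: "('a::complex_inner \<Rightarrow> 'a) \<Rightarrow> bool" where
  "compact_op T \<longleftrightarrow> bounded_clinear T \<and> compact (closure (T ` cball 0 1))"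

definition op_spectrum :: "('a::complex_inner \<Rightarrow> 'a) \<Rightarrow> complex set" where
  "op_spectrum T =
     {l. \<not> (\<exists>S. bounded_clinear S \<and>
              S \<circ> (\<lambda>x. T x - l *\<^sub>C x) = id \<and> (\<lambda>x. T x - l *\<^sub>C x) \<circ> S = id)}"

text \<open>
  The essential spectrum is the spectrum of the class of \<open>T\<close> in the Calkin algebra (bounded
  operators modulo compact operators): \<open>T - l I\<close> has no two-sided inverse modulo compacts.
\<close>

definition essential_spectrum :: "('a::complex_inner \<Rightarrow> 'a) \<Rightarrow> complex set" where
  "essential_spectrum T =
     {l. \<not> (\<exists>S. bounded_clinear S \<and>
              compact_op (\<lambda>x. S (T x - l *\<^sub>C x) - x) \<and>
              compact_op (\<lambda>x. (T (S x) - l *\<^sub>C S x) - x))}"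

text \<open>
  The sum of the squared norms does not depend on the orthonormal basis \<open>e\<close>.
\<close>

definition hilbert_schmidt :: "(nat \<Rightarrow> 'a::complex_inner) \<Rightarrow> ('a \<Rightarrow> 'a) \<Rightarrow> bool" where
  "hilbert_schmidt e K \<longleftrightarrow> bounded_clinear K \<and> summable (\<lambda>n. (norm (K (e n)))\<^sup>2)"

definition diagonal_op :: "(nat \<Rightarrow> 'a::complex_inner) \<Rightarrow> ('a \<Rightarrow> 'a) \<Rightarrow> bool" where
  "diagonal_op e T \<longleftrightarrow> bounded_clinear T \<and> (\<forall>i j. i \<noteq> j \<longrightarrow> cinner (T (e j)) (e i) = 0)"

definition diagonalizable_by_HS_perturbation :: "(nat \<Rightarrow> 'a::complex_inner) \<Rightarrow> ('a \<Rightarrow> 'a) \<Rightarrow> bool" where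
  "diagonalizable_by_HS_perturbation e N \<longleftrightarrow>
     (\<exists>U K. unitary_op U \<and> hilbert_schmidt e K \<and> U = (\<lambda>x. x + K x) \<and>
            diagonal_op e (U \<circ> N \<circ> cadjoint U))"

text \<open>
  Intended for finite nonempty \<open>X\<close>; note that \<open>infdist z {} = 0\<close>.
\<close>

definition Lim1 :: "complex set \<Rightarrow> (nat \<Rightarrow> complex) set" where
  "Lim1 X = {d. bounded (range d) \<and> summable (\<lambda>n. infdist (d n) X)}"

end

(*
  Let N = sum over l of l P_l be the spectral resolution. The essential spectrum consists of
  those l for which the sum over n of |P_l e_n|^2 diverges, and d_n is the convex combination
  of the points l with weights |P_l e_n|^2.

  If the d_n are summably close to vertices x_n, then separating x_n from the other points of the
  essential spectrum shows that the sum of |e_n - P_{x_n} e_n|^2 is finite. Hence every other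
  spectral value is inessential, and orthonormalizing the vectors P_{x_n} e_n for large n and
  completing them by eigenvectors gives an orthonormal eigenbasis f_n such that
  |f_n - e_n|^2 is summable; the unitary that maps f_n to e_n diagonalizes N.

  Conversely, for an eigenbasis f_n with eigenvalues x_n and |f_n - e_n|^2 summable, d_n - x_n is
  quadratic in e_n - f_n, and all but finitely many x_n are essential.
*)

theory Submission
  imports Defs "HOL-Complex_Analysis.Cauchy_Integral_Formula"
    "HOL-Computational_Algebra.Fundamental_Theorem_Algebra"
begin

text \<open>Two points need care. Orthonormalization must move each \<open>g n\<close> only by a
  multiple of its own error \<open>norm (e n - g n)\<close>, since an estimate that accumulates
  errors over earlier indices need not be square summable. It succeeds because \<open>g n\<close> is
  the orthogonal projection of \<open>e n\<close> to an eigenspace: within one eigenspace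
  \<open>cinner (g n) (g k)\<close> is minus a coefficient of \<open>e n - g n\<close>, and Bessel's
  inequality bounds all of these at once. Secondly, the unitary has to match indices, as a shift by
  one position would ruin summability. So the number of eigenvectors that complete the tail must
  equal the number of omitted \<open>e n\<close>, an index-zero statement obtained from a dimension
  count. The threshold 1/64 for the tail serves both: its root 1/8 keeps the tail well conditioned,
  and the loss factor 6 in norm, 36 in squares, leaves 36/64 < 1 for the dimension count. The
  spectral resolution is built without spectral measures: for a polynomial p that vanishes on the
  spectrum, p(N) is normal and quasinilpotent, hence zero.\<close>

section \<open>Complex inner product spaces\<close>

global_interpretation cvec: vector_space "scaleC :: complex \<Rightarrow> 'a \<Rightarrow> 'a::complex_inner"
  by (rule vector_space_scaleC)

lemma cinner_zero_left [simp]: "cinner 0 y = 0" for y :: "'a::complex_inner"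
  using cinner_add_left[of 0 0 y] by simp

lemma cinner_zero_right [simp]: "cinner x 0 = 0" for x :: "'a::complex_inner"
  using cinner_commute[of x 0] by simp

lemma cinner_minus_left: "cinner (- x) y = - cinner x y" for x :: "'a::complex_inner"
  using cinner_add_left[of x "- x" y] by (simp add: eq_neg_iff_add_eq_0 add.commute)

lemma cinner_diff_left: "cinner (x - y) z = cinner x z - cinner y z" for x :: "'a::complex_inner"
  using cinner_add_left[of x "- y" z] by (simp add: cinner_minus_left)

lemma cinner_add_right: "cinner x (y + z) = cinner x y + cinner x z" for x :: "'a::complex_inner"
  by (metis cinner_add_left cinner_commute complex_cnj_add)

lemma cinner_diff_right: "cinner x (y - z) = cinner x y - cinner x z" for x :: "'a::complex_inner"
  by (metis cinner_diff_left cinner_commute complex_cnj_diff)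

lemma cinner_scaleC_right: "cinner x (c *\<^sub>C y) = cnj c * cinner x y" for x :: "'a::complex_inner"
  by (metis cinner_scaleC_left cinner_commute complex_cnj_mult)

lemma cinner_sum_left: "cinner (sum f A) y = (\<Sum>i\<in>A. cinner (f i) y)"
  for f :: "'b \<Rightarrow> 'a::complex_inner"
  by (induction A rule: infinite_finite_induct) (auto simp: cinner_add_left)

lemma cinner_sum_right: "cinner y (sum f A) = (\<Sum>i\<in>A. cinner y (f i))"
  for f :: "'b \<Rightarrow> 'a::complex_inner"
  by (induction A rule: infinite_finite_induct) (auto simp: cinner_add_right)

lemma cinner_eq_zero_commute: "cinner x y = 0 \<longleftrightarrow> cinner y x = 0" for x :: "'a::complex_inner"
  by (metis cinner_commute complex_cnj_zero)

lemma norm_cinner_commute: "norm (cinner x y) = norm (cinner y x)" for x :: "'a::complex_inner"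
  by (metis cinner_commute complex_mod_cnj)

lemma cinner_self_eq_zero [simp]: "cinner x x = 0 \<longleftrightarrow> x = 0" for x :: "'a::complex_inner"
  by (simp add: cinner_self)

lemma norm_cinner_self: "norm (cinner x x) = (norm x)\<^sup>2" for x :: "'a::complex_inner"
  by (simp add: cinner_self norm_power)

lemma norm_scaleC: "norm (c *\<^sub>C x) = norm c * norm x" for x :: "'a::complex_inner"
proof -
  have "complex_of_real ((norm (c *\<^sub>C x))\<^sup>2) = c * cnj c * complex_of_real ((norm x)\<^sup>2)"
    unfolding cinner_self[symmetric] by (simp add: cinner_scaleC_left cinner_scaleC_right)
  also have "\<dots> = complex_of_real ((norm c * norm x)\<^sup>2)"
    by (simp only: complex_norm_square[symmetric] power_mult_distrib of_real_mult of_real_power)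
  finally have "(norm (c *\<^sub>C x))\<^sup>2 = (norm c * norm x)\<^sup>2"
    by (simp only: of_real_eq_iff)
  then show ?thesis
    by (simp add: power2_eq_iff_nonneg)
qed

lemma scaleC_scaleR: "c *\<^sub>C (r *\<^sub>R x) = r *\<^sub>R (c *\<^sub>C x)" for x :: "'a::complex_inner"
  by (simp add: scaleC_of_real[symmetric] scaleC_scaleC mult.commute)

lemma sgn_cnj_mult: "sgn (cnj z) * z = complex_of_real (norm z)"
proof (cases "z = 0")
  case False
  have "cnj z * z = complex_of_real (norm z) * complex_of_real (norm z)"
    by (metis complex_norm_square mult.commute of_real_power power2_eq_square)
  with False show ?thesis
    by (simp add: sgn_eq)
qed simp

lemma norm_cinner_le: "norm (cinner x y) \<le> norm x * norm y" for x :: "'a::complex_inner"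
proof -
  \<comment> \<open>Rotating \<open>x\<close> by this phase makes the complex inner product real, so
    the real Cauchy-Schwarz inequality applies.\<close>
  define c where "c = sgn (cnj (cinner x y))"
  have c: "c * cinner x y = complex_of_real (norm (cinner x y))" "norm c \<le> 1"
    unfolding c_def by (simp_all add: norm_sgn sgn_cnj_mult)
  have "norm (cinner x y) = inner (c *\<^sub>C x) y"
    using c(1) by (metis Re_cinner Re_complex_of_real cinner_scaleC_left)
  also have "\<dots> \<le> norm (c *\<^sub>C x) * norm y"
    by (rule norm_cauchy_schwarz)
  also have "\<dots> \<le> norm x * norm y"
    using c(2) by (simp add: norm_scaleC mult_left_le_one_le mult_right_mono)
  finally show ?thesis .
qed

lemma bounded_bilinear_cinner: "bounded_bilinear (cinner :: 'a::complex_inner \<Rightarrow> 'a \<Rightarrow> complex)"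
proof
  show "cinner (r *\<^sub>R x) y = r *\<^sub>R cinner x y" for r and x y :: 'a
    by (metis cinner_scaleC_left scaleC_of_real scaleR_conv_of_real)
  show "cinner x (r *\<^sub>R y) = r *\<^sub>R cinner x y" for r and x y :: 'a
    by (metis cinner_scaleC_right scaleC_of_real scaleR_conv_of_real complex_cnj_complex_of_real)
  show "\<exists>K. \<forall>a b::'a. norm (cinner a b) \<le> norm a * norm b * K"
    by (rule exI[of _ 1]) (simp add: norm_cinner_le)
qed (simp_all add: cinner_add_left cinner_add_right)

lemma bounded_bilinear_scaleC: "bounded_bilinear (scaleC :: complex \<Rightarrow> 'a::complex_inner \<Rightarrow> 'a)"
proof
  show "(r *\<^sub>R c) *\<^sub>C x = r *\<^sub>R (c *\<^sub>C x)" for r c and x :: 'a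
    by (metis scaleC_scaleC scaleC_of_real scaleR_conv_of_real)
  show "\<exists>K. \<forall>a (b::'a). norm (a *\<^sub>C b) \<le> norm a * norm b * K"
    by (rule exI[of _ 1]) (simp add: norm_scaleC)
qed (simp_all add: scaleC_add_left scaleC_add_right scaleC_scaleR)

lemmas tendsto_cinner = bounded_bilinear.tendsto[OF bounded_bilinear_cinner]

lemma sums_cinner_left: "f sums s \<Longrightarrow> (\<lambda>n. cinner (f n) y) sums cinner s y"
  by (rule bounded_linear.sums[OF bounded_bilinear.bounded_linear_left[OF bounded_bilinear_cinner]])

lemma norm_add_square:
  fixes x :: "'a::complex_inner"
  assumes "cinner x y = 0"
  shows "(norm (x + y))\<^sup>2 = (norm x)\<^sup>2 + (norm y)\<^sup>2"
proof -
  have "inner x y = 0"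
    using assms Re_cinner[of x y] by simp
  then show ?thesis
    by (simp add: power2_norm_eq_inner inner_add inner_commute)
qed

lemma norm_sum_square:
  fixes f :: "'b \<Rightarrow> 'a::complex_inner"
  assumes "finite A" "\<And>i j. i \<in> A \<Longrightarrow> j \<in> A \<Longrightarrow> i \<noteq> j \<Longrightarrow> cinner (f i) (f j) = 0"
  shows "(norm (sum f A))\<^sup>2 = (\<Sum>i\<in>A. (norm (f i))\<^sup>2)"
  using assms
proof (induction A)
  case (insert a A)
  have "cinner (f a) (sum f A) = 0"
    unfolding cinner_sum_right using insert by (intro sum.neutral) auto
  then have "(norm (f a + sum f A))\<^sup>2 = (norm (f a))\<^sup>2 + (norm (sum f A))\<^sup>2"
    by (rule norm_add_square)
  with insert show ?case
    by auto
qed simp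

subsection \<open>Bounded operators and adjoints\<close>

lemma bounded_clinearI:
  assumes "\<And>x y. T (x + y) = T x + T y" "\<And>c x. T (c *\<^sub>C x) = c *\<^sub>C T x"
    and "\<And>x. norm (T x) \<le> norm x * B"
  shows "bounded_clinear T"
  unfolding bounded_clinear_def
proof (intro conjI bounded_linear_intro allI)
  show "T (r *\<^sub>R x) = r *\<^sub>R T x" for r x
    using assms(2)[of "complex_of_real r" x] by (simp add: scaleC_of_real)
qed (use assms in auto)

lemma bounded_clinear_bounded_linear: "bounded_clinear T \<Longrightarrow> bounded_linear T"
  and bounded_clinear_scaleC: "bounded_clinear T \<Longrightarrow> T (c *\<^sub>C x) = c *\<^sub>C T x"
  by (auto simp: bounded_clinear_def)

lemma bounded_clinear_add: "bounded_clinear T \<Longrightarrow> T (x + y) = T x + T y"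
  and bounded_clinear_diff: "bounded_clinear T \<Longrightarrow> T (x - y) = T x - T y"
  and bounded_clinear_zero: "bounded_clinear T \<Longrightarrow> T 0 = 0"
  and bounded_clinear_sum: "bounded_clinear T \<Longrightarrow> T (sum f A) = (\<Sum>i\<in>A. T (f i))"
  by (rule linear_add linear_diff linear_0 linear_sum;
      blast intro: bounded_linear.linear bounded_clinear_bounded_linear)+

lemma bounded_clinear_pos_bound:
  assumes "bounded_clinear T"
  obtains B where "B > 0" "\<And>x. norm (T x) \<le> B * norm x"
  using bounded_linear.pos_bounded[OF bounded_clinear_bounded_linear[OF assms]]
  by (auto simp: mult.commute)

lemma bounded_clinear_compose:
  "bounded_clinear S \<Longrightarrow> bounded_clinear T \<Longrightarrow> bounded_clinear (\<lambda>x. S (T x))"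
  by (auto simp: bounded_clinear_def intro: bounded_linear_compose)

lemma bounded_clinear_ident: "bounded_clinear (\<lambda>x. x)"
  by (simp add: bounded_clinear_def)

lemma bounded_clinear_plus:
  "bounded_clinear S \<Longrightarrow> bounded_clinear T \<Longrightarrow> bounded_clinear (\<lambda>x. S x + T x)"
  by (auto simp: bounded_clinear_def scaleC_add_right intro: bounded_linear_add)

lemma bounded_clinear_smult:
  assumes "bounded_clinear T"
  shows "bounded_clinear (\<lambda>x. c *\<^sub>C T x)"
  unfolding bounded_clinear_def
proof (intro conjI allI)
  show "bounded_linear (\<lambda>x. c *\<^sub>C T x)"
    using bounded_linear_compose[OF bounded_bilinear.bounded_linear_right
        [OF bounded_bilinear_scaleC] bounded_clinear_bounded_linear[OF assms]] .
qed (simp add: bounded_clinear_scaleC[OF assms] scaleC_scaleC mult.commute)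

lemma bounded_clinear_const_zero: "bounded_clinear (\<lambda>x. 0)"
  by (rule bounded_clinearI[of _ 0]) (auto simp: cvec.scale_zero_right)

lemma bounded_clinear_minus_op:
  assumes "bounded_clinear S" "bounded_clinear T"
  shows "bounded_clinear (\<lambda>x. S x - T x)"
  using bounded_clinear_plus[OF assms(1) bounded_clinear_smult[OF assms(2), of "- 1"]]
  by (simp add: cvec.scale_minus_left)

lemma cinner_ext_right:
  fixes y :: "'a::complex_inner"
  assumes "\<And>x. cinner x y = cinner x z"
  shows "y = z"
proof -
  have "cinner (y - z) (y - z) = 0"
    by (simp only: cinner_diff_right assms diff_self)
  then show ?thesis
    by simp
qed

lemma cadjoint_eqI:
  assumes "\<And>x y. cinner (T x) y = cinner x (S y)"
  shows "cadjoint T = S"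
proof
  fix y
  have "\<forall>x y. cinner (T x) y = cinner x (cadjoint T y)"
    unfolding cadjoint_def by (rule someI[of _ S]) (blast intro: assms)
  then show "cadjoint T y = S y"
    by (intro cinner_ext_right) (simp flip: assms)
qed

text \<open>A relation instead of the chosen \<open>cadjoint\<close>, so that adjoint pairs can be
  handled by exhibiting them.\<close>

definition is_adjoint :: "('a::complex_inner \<Rightarrow> 'a) \<Rightarrow> ('a \<Rightarrow> 'a) \<Rightarrow> bool" where
  "is_adjoint T S \<longleftrightarrow> (\<forall>x y. cinner (T x) y = cinner x (S y))"

lemma is_adjoint_sym: "is_adjoint T S \<Longrightarrow> is_adjoint S T"
  unfolding is_adjoint_def by (metis cinner_commute)

text \<open>The square of \<open>norm (S y)\<close> is \<open>cinner (T (S y)) y\<close>; the bound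
  of \<open>T\<close> leaves one factor \<open>norm (S y)\<close> to cancel.\<close>

lemma bounded_clinear_adjoint:
  assumes "is_adjoint T S" "bounded_clinear T"
  shows "bounded_clinear S"
proof -
  obtain B where B: "B > 0" "\<And>x. norm (T x) \<le> B * norm x"
    using bounded_clinear_pos_bound[OF assms(2)] by blast
  have adj: "cinner x (S y) = cinner (T x) y" for x y
    using assms(1) by (simp add: is_adjoint_def)
  show ?thesis
  proof (rule bounded_clinearI[of _ B])
    fix y
    have "(norm (S y))\<^sup>2 = norm (cinner (T (S y)) y)"
      by (simp add: norm_cinner_self flip: adj)
    also have "\<dots> \<le> B * norm (S y) * norm y"
      by (meson B(2) mult_right_mono norm_cinner_le norm_ge_zero order_trans)
    finally show "norm (S y) \<le> norm y * B"
      by (cases "norm (S y) = 0") (use B in \<open>auto simp: power2_eq_square mult_ac\<close>)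
  qed (rule cinner_ext_right; simp add: adj cinner_add_right cinner_scaleC_right)+
qed

section \<open>Orthonormal systems\<close>

instance chilbert_space \<subseteq> banach ..

definition orthonormal_on :: "'i set \<Rightarrow> ('i \<Rightarrow> 'a::complex_inner) \<Rightarrow> bool" where
  "orthonormal_on I f \<longleftrightarrow> (\<forall>i\<in>I. \<forall>j\<in>I. cinner (f i) (f j) = (if i = j then 1 else 0))"

lemma orthonormal_onD: "orthonormal_on I f \<Longrightarrow> i \<in> I \<Longrightarrow> j \<in> I \<Longrightarrow> cinner (f i) (f j) = (if i = j then 1 else 0)"
  by (simp add: orthonormal_on_def)

lemma orthonormal_on_subset: "orthonormal_on I f \<Longrightarrow> J \<subseteq> I \<Longrightarrow> orthonormal_on J f"
  unfolding orthonormal_on_def by blast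

lemma orthonormal_on_norm:
  assumes "orthonormal_on I f" "i \<in> I"
  shows "norm (f i) = 1"
proof -
  have "(norm (f i))\<^sup>2 = 1\<^sup>2"
    using orthonormal_onD[OF assms(1,2,2)] norm_cinner_self[of "f i"] by simp
  then show ?thesis
    by (simp only: power2_eq_iff_nonneg norm_ge_zero zero_le_one)
qed

lemma cinner_lincomb:
  assumes "finite I" "orthonormal_on I f" "j \<in> I"
  shows "cinner (\<Sum>i\<in>I. c i *\<^sub>C f i) (f j) = c j"
proof -
  have "cinner (\<Sum>i\<in>I. c i *\<^sub>C f i) (f j) = (\<Sum>i\<in>I. if j = i then c i else 0)"
    unfolding cinner_sum_left
    by (intro sum.cong refl) (use assms in \<open>auto simp: cinner_scaleC_left orthonormal_onD\<close>)
  with assms show ?thesis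
    by simp
qed

lemma norm_lincomb:
  assumes "finite I" "orthonormal_on I f"
  shows "(norm (\<Sum>i\<in>I. c i *\<^sub>C f i))\<^sup>2 = (\<Sum>i\<in>I. (norm (c i))\<^sup>2)"
proof -
  have "(norm (\<Sum>i\<in>I. c i *\<^sub>C f i))\<^sup>2 = (\<Sum>i\<in>I. (norm (c i *\<^sub>C f i))\<^sup>2)"
    using assms
    by (intro norm_sum_square) (auto simp: cinner_scaleC_left cinner_scaleC_right orthonormal_onD)
  also have "\<dots> = (\<Sum>i\<in>I. (norm (c i))\<^sup>2)"
    by (intro sum.cong refl) (simp add: norm_scaleC orthonormal_on_norm[OF assms(2)])
  finally show ?thesis .
qed

lemma cinner_diff_proj:
  assumes "finite I" "orthonormal_on I f" "j \<in> I"
  shows "cinner (x - (\<Sum>i\<in>I. cinner x (f i) *\<^sub>C f i)) (f j) = 0"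
  by (simp only: cinner_diff_left cinner_lincomb[OF assms] diff_self)

lemma bessel:
  assumes "finite I" "orthonormal_on I f"
  shows "(\<Sum>i\<in>I. (norm (cinner x (f i)))\<^sup>2) \<le> (norm x)\<^sup>2"
proof -
  let ?y = "\<Sum>i\<in>I. cinner x (f i) *\<^sub>C f i"
  have "cinner (x - ?y) ?y = 0"
    unfolding cinner_sum_right cinner_scaleC_right
    by (intro sum.neutral ballI) (simp add: cinner_diff_proj[OF assms])
  then have "(norm (x - ?y + ?y))\<^sup>2 = (norm (x - ?y))\<^sup>2 + (norm ?y)\<^sup>2"
    by (rule norm_add_square)
  then show ?thesis
    by (simp add: norm_lincomb[OF assms])
qed

lemma bessel_summable:
  fixes f :: "nat \<Rightarrow> 'a::complex_inner"
  assumes "orthonormal_on UNIV f"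
  shows "summable (\<lambda>n. (norm (cinner x (f n)))\<^sup>2)"
  by (rule summableI_nonneg_bounded[of _ "(norm x)\<^sup>2"])
     (auto intro: bessel orthonormal_on_subset[OF assms])

text \<open>By Pythagoras the blocks of the vector series have the same squared norms as the blocks
  of the scalar series.\<close>

lemma riesz_fischer:
  fixes f :: "nat \<Rightarrow> 'a::chilbert_space"
  assumes "orthonormal_on UNIV f" "summable (\<lambda>n. (norm (c n))\<^sup>2)"
  shows "summable (\<lambda>n. c n *\<^sub>C f n)"
  unfolding summable_Cauchy
proof (intro allI impI)
  fix \<epsilon> :: real
  assume "\<epsilon> > 0"
  then obtain M where M: "\<And>m n. m \<ge> M \<Longrightarrow> norm (\<Sum>k=m..<n. (norm (c k))\<^sup>2) < \<epsilon>\<^sup>2"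
    using assms(2) unfolding summable_Cauchy by (meson zero_less_power)
  show "\<exists>M. \<forall>m\<ge>M. \<forall>n. norm (\<Sum>k=m..<n. c k *\<^sub>C f k) < \<epsilon>"
  proof (intro exI allI impI)
    fix m n
    assume "m \<ge> M"
    have "(norm (\<Sum>k=m..<n. c k *\<^sub>C f k))\<^sup>2 = (\<Sum>k=m..<n. (norm (c k))\<^sup>2)"
      by (intro norm_lincomb orthonormal_on_subset[OF assms(1)]) auto
    also have "\<dots> < \<epsilon>\<^sup>2"
      using M[OF \<open>m \<ge> M\<close>, of n] by simp
    finally show "norm (\<Sum>k=m..<n. c k *\<^sub>C f k) < \<epsilon>"
      using \<open>\<epsilon> > 0\<close> by (simp add: power_less_imp_less_base)
  qed
qed

lemma cinner_suminf:
  fixes f :: "nat \<Rightarrow> 'a::chilbert_space"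
  assumes "orthonormal_on UNIV f" "summable (\<lambda>n. (norm (c n))\<^sup>2)"
  shows "cinner (\<Sum>n. c n *\<^sub>C f n) (f k) = c k"
proof -
  have "(\<lambda>n. cinner (c n *\<^sub>C f n) (f k)) sums cinner (\<Sum>n. c n *\<^sub>C f n) (f k)"
    by (intro sums_cinner_left summable_sums riesz_fischer assms)
  moreover have "(\<lambda>n. cinner (c n *\<^sub>C f n) (f k)) = (\<lambda>n. if n = k then c n else 0)"
    by (auto simp: cinner_scaleC_left orthonormal_onD[OF assms(1)])
  ultimately have "(\<lambda>n. if n = k then c n else 0) sums cinner (\<Sum>n. c n *\<^sub>C f n) (f k)"
    by simp
  from sums_unique2[OF this sums_single] show ?thesis .
qed

text \<open>Completeness as a trivial orthogonal complement: this is the form that can be checked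
  for an eigenbasis and that drives the expansion below.\<close>

definition total_orthonormal :: "(nat \<Rightarrow> 'a::complex_inner) \<Rightarrow> bool" where
  "total_orthonormal f \<longleftrightarrow>
     orthonormal_on UNIV f \<and> (\<forall>x. (\<forall>n. cinner x (f n) = 0) \<longrightarrow> x = 0)"

lemma total_orthonormalD:
  assumes "total_orthonormal f"
  shows "orthonormal_on UNIV f" "(\<And>n. cinner x (f n) = 0) \<Longrightarrow> x = 0"
  using assms by (auto simp: total_orthonormal_def)

lemma total_orthonormal_ext:
  assumes "total_orthonormal f" "\<And>n. cinner x (f n) = cinner y (f n)"
  shows "x = y"
  using total_orthonormalD(2)[OF assms(1), of "x - y"] assms(2) by (simp add: cinner_diff_left)

text \<open>The vectors orthogonal to \<open>x\<close> form a closed subspace; once it contains the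
  basis it is everything, \<open>x\<close> included.\<close>

lemma orthonormal_basis_total:
  fixes e :: "nat \<Rightarrow> 'a::complex_inner"
  assumes "orthonormal_basis e"
  shows "total_orthonormal e"
  unfolding total_orthonormal_def
proof (intro conjI allI impI)
  show "orthonormal_on UNIV e"
    using assms by (simp add: orthonormal_basis_def orthonormal_on_def)
  fix x
  assume x: "\<forall>n. cinner x (e n) = 0"
  let ?S = "{y. cinner x y = 0}"
  have "module.subspace scaleC ?S"
    by (auto simp: cvec.subspace_def cinner_add_right cinner_scaleC_right)
  then have "module.span scaleC (range e) \<subseteq> ?S"
    using x by (intro cvec.span_minimal) auto
  moreover have "closed ?S"
    by (intro closed_Collect_eq continuous_intros
        bounded_linear.continuous_on[OF bounded_bilinear.bounded_linear_right[OF bounded_bilinear_cinner]])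
  ultimately have "closure (module.span scaleC (range e)) \<subseteq> ?S"
    by (rule closure_minimal)
  then have "?S = UNIV"
    using assms by (auto simp only: orthonormal_basis_def)
  then have "x \<in> ?S"
    by simp
  then show "x = 0"
    by simp
qed

section \<open>Expansions, Parseval's identity, adjoints and changes of basis\<close>

lemma total_orthonormal_expansion:
  fixes f :: "nat \<Rightarrow> 'a::chilbert_space"
  assumes "total_orthonormal f"
  shows "(\<lambda>n. cinner x (f n) *\<^sub>C f n) sums x"
proof -
  note on = total_orthonormalD(1)[OF assms]
  have "(\<Sum>n. cinner x (f n) *\<^sub>C f n) = x"
    by (rule total_orthonormal_ext[OF assms]) (rule cinner_suminf[OF on bessel_summable[OF on]])
  then show ?thesis
    using summable_sums[OF riesz_fischer[OF on bessel_summable[OF on]]] by metis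
qed

lemma cinner_sums:
  fixes f :: "nat \<Rightarrow> 'a::chilbert_space"
  assumes "total_orthonormal f"
  shows "(\<lambda>n. cinner x (f n) * cinner (f n) y) sums cinner x y"
  using sums_cinner_left[OF total_orthonormal_expansion[OF assms], of x y]
  by (simp add: cinner_scaleC_left)

lemma parseval:
  fixes f :: "nat \<Rightarrow> 'a::chilbert_space"
  assumes "total_orthonormal f"
  shows "(\<lambda>n. (norm (cinner x (f n)))\<^sup>2) sums (norm x)\<^sup>2"
proof -
  have "complex_of_real ((norm (cinner x (f n)))\<^sup>2) = cinner x (f n) * cinner (f n) x" for n
    by (metis cinner_commute complex_norm_square)
  then have "(\<lambda>n. complex_of_real ((norm (cinner x (f n)))\<^sup>2)) sums complex_of_real ((norm x)\<^sup>2)"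
    using cinner_sums[OF assms, of x x] by (simp add: cinner_self)
  then show ?thesis
    by (simp only: sums_of_real_iff)
qed

lemma adjoint_exists:
  fixes e :: "nat \<Rightarrow> 'a::chilbert_space" and T :: "'a \<Rightarrow> 'a"
  assumes "total_orthonormal e" "bounded_clinear T"
  obtains S where "is_adjoint T S"
proof -
  note on = total_orthonormalD(1)[OF assms(1)]
  obtain B where B: "B > 0" "\<And>x. norm (T x) \<le> B * norm x"
    using bounded_clinear_pos_bound[OF assms(2)] by blast
  \<comment> \<open>The coefficients expected of the adjoint at \<open>y\<close>. Testing
    \<open>T\<close> on the truncated vector \<open>?z\<close> with these coefficients gives
    \<open>(norm ?z)^2\<close> on one side and at most \<open>norm y * B * norm ?z\<close> on the
    other.\<close>
  have summ: "summable (\<lambda>n. (norm (cinner y (T (e n))))\<^sup>2)" for y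
  proof (rule summableI_nonneg_bounded)
    fix n
    let ?c = "\<lambda>n. cinner y (T (e n))"
    define s where "s = (\<Sum>i<n. (norm (?c i))\<^sup>2)"
    let ?z = "\<Sum>i<n. ?c i *\<^sub>C e i"
    have nz: "(norm ?z)\<^sup>2 = s"
      unfolding s_def by (intro norm_lincomb orthonormal_on_subset[OF on]) auto
    have "cinner y (T ?z) = (\<Sum>i<n. cnj (?c i) * ?c i)"
      by (simp add: bounded_clinear_sum[OF assms(2)] bounded_clinear_scaleC[OF assms(2)]
          cinner_sum_right cinner_scaleC_right)
    also have "\<dots> = complex_of_real s"
      unfolding s_def of_real_sum by (intro sum.cong refl) (metis complex_norm_square mult.commute)
    finally have "s \<le> norm (cinner y (T ?z))"
      by simp
    also have "\<dots> \<le> norm y * (B * norm ?z)"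
      by (meson B(2) mult_left_mono norm_cinner_le norm_ge_zero order_trans)
    finally have "norm ?z * norm ?z \<le> (norm y * B) * norm ?z"
      by (simp add: nz[symmetric] power2_eq_square mult_ac)
    then have "norm ?z \<le> norm y * B"
      by (cases "norm ?z = 0") (use B in auto)
    then have "(norm ?z)\<^sup>2 \<le> (norm y * B)\<^sup>2"
      by (intro power_mono) auto
    then show "(\<Sum>i<n. (norm (?c i))\<^sup>2) \<le> (norm y * B)\<^sup>2"
      using nz by (simp add: s_def)
  qed auto
  define S where "S = (\<lambda>y. \<Sum>n. cinner y (T (e n)) *\<^sub>C e n)"
  have S: "cinner (S y) (e n) = cinner y (T (e n))" for y n
    unfolding S_def by (rule cinner_suminf[OF on summ])
  have "cinner (T x) y = cinner x (S y)" for x y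
  proof -
    have "(\<lambda>n. T (cinner x (e n) *\<^sub>C e n)) sums T x"
      by (intro bounded_linear.sums[OF bounded_clinear_bounded_linear[OF assms(2)]]
          total_orthonormal_expansion assms)
    then have "(\<lambda>n. cinner (T (cinner x (e n) *\<^sub>C e n)) y) sums cinner (T x) y"
      by (rule sums_cinner_left)
    moreover have "cinner (T (cinner x (e n) *\<^sub>C e n)) y = cinner x (e n) * cinner (e n) (S y)" for n
      using S[of y n] by (simp add: bounded_clinear_scaleC[OF assms(2)] cinner_scaleC_left)
        (metis cinner_commute)
    ultimately have "(\<lambda>n. cinner x (e n) * cinner (e n) (S y)) sums cinner (T x) y"
      by simp
    from sums_unique2[OF this cinner_sums[OF assms(1)]] show ?thesis .
  qed
  then show thesis
    by (intro that[of S]) (simp add: is_adjoint_def)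
qed

lemma is_adjoint_cadjoint:
  fixes e :: "nat \<Rightarrow> 'a::chilbert_space" and T :: "'a \<Rightarrow> 'a"
  assumes "total_orthonormal e" "bounded_clinear T"
  shows "is_adjoint T (cadjoint T)"
proof -
  obtain S where S: "is_adjoint T S"
    using adjoint_exists[OF assms] .
  then have "cadjoint T = S"
    by (intro cadjoint_eqI) (simp add: is_adjoint_def)
  with S show ?thesis
    by simp
qed

text \<open>The unitary that carries \<open>f n\<close> to \<open>e n\<close>; exchanging the two
  bases gives both its inverse and its adjoint.\<close>

definition basis_map :: "(nat \<Rightarrow> 'a::chilbert_space) \<Rightarrow> (nat \<Rightarrow> 'a) \<Rightarrow> 'a \<Rightarrow> 'a" where
  "basis_map f e x = (\<Sum>n. cinner x (f n) *\<^sub>C e n)"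

lemma
  assumes f: "total_orthonormal f" and e: "total_orthonormal e"
  shows basis_map_inverse: "basis_map e f (basis_map f e x) = x"
    and basis_map_basis: "basis_map f e (f n) = e n"
    and bounded_clinear_basis_map: "bounded_clinear (basis_map f e)"
    and norm_basis_map: "norm (basis_map f e x) = norm x"
    and cadjoint_basis_map: "cadjoint (basis_map f e) = basis_map e f"
proof -
  have coeff: "cinner (basis_map f e x) (e n) = cinner x (f n)"
    if "total_orthonormal f" "total_orthonormal e" for f e :: "nat \<Rightarrow> 'a" and x n
    unfolding basis_map_def
    by (intro cinner_suminf total_orthonormalD(1) bessel_summable that)
  note ext = total_orthonormal_ext[OF e]
  show "basis_map e f (basis_map f e x) = x" for x
    by (rule total_orthonormal_ext[OF f]) (simp only: coeff[OF f e] coeff[OF e f])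
  show "basis_map f e (f n) = e n" for n
    by (rule ext)
       (simp add: coeff[OF f e] orthonormal_onD[OF total_orthonormalD(1)[OF f]]
         orthonormal_onD[OF total_orthonormalD(1)[OF e]])
  have nrm: "norm (basis_map f e x) = norm x" for x
  proof -
    have "(norm (basis_map f e x))\<^sup>2 = (norm x)\<^sup>2"
      using parseval[OF e, of "basis_map f e x"] parseval[OF f, of x]
      unfolding coeff[OF f e] by (rule sums_unique2)
    then show ?thesis
      by (simp only: power2_eq_iff_nonneg norm_ge_zero)
  qed
  then show "norm (basis_map f e x) = norm x" for x .
  show "bounded_clinear (basis_map f e)"
    by (rule bounded_clinearI[of _ 1]; (rule ext)?)
       (simp_all add: coeff[OF f e] cinner_add_left cinner_scaleC_left nrm)
  show "cadjoint (basis_map f e) = basis_map e f"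
  proof (rule cadjoint_eqI)
    fix x y
    have "(\<lambda>n. cinner (basis_map f e x) (e n) * cinner (e n) y) sums cinner (basis_map f e x) y"
      by (rule cinner_sums[OF e])
    moreover have "cinner (basis_map f e x) (e n) * cinner (e n) y
        = cinner x (f n) * cinner (f n) (basis_map e f y)" for n
      using coeff[OF e f, of y n] by (simp add: coeff[OF f e]) (metis cinner_commute)
    ultimately have "(\<lambda>n. cinner x (f n) * cinner (f n) (basis_map e f y)) sums cinner (basis_map f e x) y"
      by simp
    from sums_unique2[OF this cinner_sums[OF f]]
    show "cinner (basis_map f e x) y = cinner x (basis_map e f y)" .
  qed
qed

lemma unitary_basis_map:
  assumes "total_orthonormal f" "total_orthonormal e"
  shows "unitary_op (basis_map f e)"
  unfolding unitary_op_def cadjoint_basis_map[OF assms]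
  using assms by (auto simp: fun_eq_iff basis_map_inverse bounded_clinear_basis_map)

section \<open>The spectral theorem for normal operators with finite spectrum\<close>

subsection \<open>Polynomials in an operator\<close>

text \<open>Horner's scheme with \<open>T\<close> applied to the argument and not to the value, so
  that sums and scalar multiples of polynomials need no linearity of \<open>T\<close>.\<close>

definition poly_op :: "('a::complex_inner \<Rightarrow> 'a) \<Rightarrow> complex poly \<Rightarrow> 'a \<Rightarrow> 'a" where
  "poly_op T p = fold_coeffs (\<lambda>a f x. a *\<^sub>C x + f (T x)) p (\<lambda>x. 0)"

lemma poly_op_0 [simp]: "poly_op T 0 x = 0"
  by (simp add: poly_op_def)

lemma poly_op_pCons [simp]: "poly_op T (pCons a p) x = a *\<^sub>C x + poly_op T p (T x)"
  by (cases "p = 0 \<and> a = 0") (auto simp: poly_op_def)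

lemma bounded_clinear_poly_op:
  assumes "bounded_clinear T"
  shows "bounded_clinear (poly_op T p)"
proof (induction p)
  case 0
  have "poly_op T 0 = (\<lambda>x. 0)"
    by auto
  then show ?case
    using bounded_clinear_const_zero by metis
next
  case (pCons a p)
  have "poly_op T (pCons a p) = (\<lambda>x. a *\<^sub>C x + poly_op T p (T x))"
    by auto
  moreover have "bounded_clinear \<dots>"
    by (intro bounded_clinear_plus bounded_clinear_smult bounded_clinear_ident
        bounded_clinear_compose[OF pCons(2) assms])
  ultimately show ?case
    by simp
qed

lemma poly_op_commute:
  assumes "bounded_clinear S" "\<And>x. S (T x) = T (S x)"
  shows "S (poly_op T p x) = poly_op T p (S x)"
  by (induction p arbitrary: x)
     (simp_all add: bounded_clinear_zero[OF assms(1)] bounded_clinear_add[OF assms(1)]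
       bounded_clinear_scaleC[OF assms(1)] assms(2))

lemma poly_op_add: "poly_op T (p + q) x = poly_op T p x + poly_op T q x"
  by (induction p q arbitrary: x rule: poly_induct2) (simp_all add: scaleC_add_left)

lemma poly_op_smult: "poly_op T (smult c p) x = c *\<^sub>C poly_op T p x"
  by (induction p arbitrary: x) (simp_all add: scaleC_add_right scaleC_scaleC)

lemma poly_op_mult:
  assumes "bounded_clinear T"
  shows "poly_op T (p * q) x = poly_op T p (poly_op T q x)"
  by (induction p arbitrary: x)
     (simp_all add: poly_op_add poly_op_smult poly_op_commute[OF assms])

definition cinvertible :: "('a::complex_inner \<Rightarrow> 'a) \<Rightarrow> bool" where
  "cinvertible T \<longleftrightarrow> (\<exists>S. bounded_clinear S \<and> S \<circ> T = id \<and> T \<circ> S = id)"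

lemma not_in_op_spectrum: "l \<notin> op_spectrum T \<longleftrightarrow> cinvertible (\<lambda>x. T x - l *\<^sub>C x)"
  by (auto simp: op_spectrum_def cinvertible_def)

lemma cinvertible_compose:
  assumes "cinvertible S" "cinvertible T"
  shows "cinvertible (S \<circ> T)"
proof -
  obtain S' T' where *: "bounded_clinear S'" "bounded_clinear T'" "S' \<circ> S = id" "S \<circ> S' = id"
      "T' \<circ> T = id" "T \<circ> T' = id"
    using assms unfolding cinvertible_def by blast
  show ?thesis
    unfolding cinvertible_def
  proof (intro exI conjI)
    show "bounded_clinear (T' \<circ> S')"
      using bounded_clinear_compose[OF *(2,1)] by (simp add: comp_def)
    show "T' \<circ> S' \<circ> (S \<circ> T) = id" "S \<circ> T \<circ> (T' \<circ> S') = id"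
      using *(3-) by (simp_all add: fun_eq_iff)
  qed
qed

text \<open>One half of the spectral mapping theorem: over the complex numbers \<open>q\<close>
  splits into linear factors, each of which gives an invertible operator.\<close>

lemma cinvertible_poly_op:
  assumes T: "bounded_clinear T" and "q \<noteq> 0"
    and "\<And>z. poly q z = 0 \<Longrightarrow> z \<notin> op_spectrum T"
  shows "cinvertible (poly_op T q)"
  using assms(2,3)
proof (induction "degree q" arbitrary: q)
  case 0
  then obtain c where q: "q = [:c:]"
    by (metis degree_0_id)
  with 0 have "c \<noteq> 0"
    by auto
  with q show ?case
    unfolding cinvertible_def
    by (intro exI[of _ "\<lambda>x. inverse c *\<^sub>C x"])
       (simp add: fun_eq_iff scaleC_scaleC bounded_clinear_smult[OF bounded_clinear_ident])
next
  case (Suc n)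
  then have "\<not> constant (poly q)"
    by (simp add: constant_degree)
  then obtain z where z: "poly q z = 0"
    using fundamental_theorem_of_algebra by blast
  then obtain r where r: "q = [:- z, 1:] * r"
    by (metis dvdE poly_eq_0_iff_dvd)
  with Suc have "r \<noteq> 0"
    by auto
  then have "degree q = degree [:- z, 1:] + degree r"
    unfolding r by (intro degree_mult_eq) auto
  with Suc(2) have "n = degree r"
    by simp
  then have "cinvertible (poly_op T r)"
    using Suc.hyps(1) Suc.prems \<open>r \<noteq> 0\<close> by (simp add: r)
  moreover have "cinvertible (poly_op T [:- z, 1:])"
  proof -
    have "poly_op T [:- z, 1:] = (\<lambda>x. T x - z *\<^sub>C x)"
      by (auto simp: cvec.scale_minus_left)
    then show ?thesis
      using Suc.prems(2)[OF z] by (simp add: not_in_op_spectrum)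
  qed
  moreover have "poly_op T q = poly_op T [:- z, 1:] \<circ> poly_op T r"
    unfolding r by (rule ext) (simp only: poly_op_mult[OF T] comp_def)
  ultimately show ?case
    by (metis cinvertible_compose)
qed

subsection \<open>Normal operators\<close>

lemma normal_norm_adjoint:
  assumes "is_adjoint M A" "\<And>x. M (A x) = A (M x)"
  shows "norm (A x) = norm (M x)"
proof -
  have adj: "cinner (M x) y = cinner x (A y)" for x y
    using assms(1) by (simp add: is_adjoint_def)
  have "cinner (A x) (A x) = cinner (A (M x)) x"
    by (simp only: adj[symmetric] assms(2))
  also have "\<dots> = cinner (M x) (M x)"
    using is_adjoint_sym[OF assms(1)] by (simp add: is_adjoint_def)
  finally have "cinner (A x) (A x) = cinner (M x) (M x)" .
  then have "(norm (A x))\<^sup>2 = (norm (M x))\<^sup>2"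
    by (simp only: cinner_self of_real_eq_iff)
  then show ?thesis
    by (simp only: power2_eq_iff_nonneg norm_ge_zero)
qed

text \<open>For normal \<open>M\<close> the norms along an orbit are logarithmically convex, so each
  step multiplies the norm at least by the first ratio \<open>norm (M x)\<close>.\<close>

lemma normal_orbit_growth:
  assumes "is_adjoint M A" "\<And>x. M (A x) = A (M x)" "norm x = 1"
  shows "norm (M x) ^ n \<le> norm ((M ^^ n) x)"
proof -
  have adj: "cinner (M x) y = cinner x (A y)" for x y
    using assms(1) by (simp add: is_adjoint_def)
  have convex: "(norm (M z))\<^sup>2 \<le> norm z * norm (M (M z))" for z
  proof -
    have "(norm (M z))\<^sup>2 = norm (cinner z (A (M z)))"
      by (simp add: norm_cinner_self flip: adj)
    also have "\<dots> \<le> norm z * norm (A (M z))"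
      by (rule norm_cinner_le)
    finally show ?thesis
      by (simp add: normal_norm_adjoint[OF assms(1,2)])
  qed
  show ?thesis
  proof (cases "M x = 0")
    case True
    with assms(3) show ?thesis
      by (cases n) auto
  next
    case False
    define s where "s = norm (M x)"
    have "s > 0"
      using False by (simp add: s_def)
    \<comment> \<open>The bound on the next ratio is carried along; the bound on the norm alone is
      not inductive.\<close>
    have "s ^ n \<le> norm ((M ^^ n) x) \<and> s * norm ((M ^^ n) x) \<le> norm ((M ^^ Suc n) x)"
    proof (induction n)
      case 0
      show ?case
        using assms(3) by (simp add: s_def)
    next
      case (Suc n)
      let ?a = "norm ((M ^^ n) x)" and ?b = "norm ((M ^^ Suc n) x)" and ?c = "norm ((M ^^ Suc (Suc n)) x)"
      have "s ^ Suc n \<le> s * ?a"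
        using Suc \<open>s > 0\<close> by simp
      with Suc have 1: "s ^ Suc n \<le> ?b"
        by linarith
      have "?a > 0"
        using Suc \<open>s > 0\<close> by (meson less_le_trans zero_less_power)
      have "s * ?a * ?b \<le> ?b * ?b"
        using Suc by (intro mult_right_mono) auto
      also have "\<dots> \<le> ?a * ?c"
        using convex[of "(M ^^ n) x"] by (simp add: power2_eq_square)
      finally have "?a * (s * ?b) \<le> ?a * ?c"
        by (simp add: mult_ac)
      then have "s * ?b \<le> ?c"
        using \<open>?a > 0\<close> by (rule mult_left_le_imp_le)
      with 1 show ?case
        by blast
    qed
    then show ?thesis
      by (simp add: s_def)
  qed
qed

text \<open>
  The resolvent is entire, so Cauchy's inequality bounds its Taylor coefficients on every circle;
  this is incompatible with the growth of the orbits of a nonzero normal operator.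
\<close>

lemma normal_quasinilpotent_zero:
  fixes M :: "'a::chilbert_space \<Rightarrow> 'a"
  assumes M: "bounded_clinear M"
    and A: "is_adjoint M A" "\<And>x. M (A x) = A (M x)"
    and inv: "\<And>w. cinvertible (\<lambda>x. x - w *\<^sub>C M x)"
  shows "M x = 0"
proof -
  obtain R where R: "\<And>w. bounded_clinear (R w)" "\<And>w. R w \<circ> (\<lambda>x. x - w *\<^sub>C M x) = id"
      "\<And>w. (\<lambda>x. x - w *\<^sub>C M x) \<circ> R w = id"
    using inv unfolding cinvertible_def by metis
  have R_left: "R w (x - w *\<^sub>C M x) = x" for w x
    using fun_cong[OF R(2)[of w], of x] by simp
  have R_right: "R w x - w *\<^sub>C M (R w x) = x" for w x
    using fun_cong[OF R(3)[of w], of x] by simp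
  obtain B where B: "B > 0" "\<And>x. norm (M x) \<le> B * norm x"
    using bounded_clinear_pos_bound[OF M] by blast
  have "\<exists>C. C > 0 \<and> (\<forall>x. norm (R w x) \<le> C * norm x)" for w
    using bounded_clinear_pos_bound[OF R(1)[of w]] by metis
  then obtain C where C: "\<And>w. C w > 0" "\<And>w x. norm (R w x) \<le> C w * norm x"
    by metis
  \<comment> \<open>On this radius the term produced by \<open>w - w0\<close> is at most
    \<open>norm ?v / 2\<close> and is absorbed on the left. The inverses \<open>R w\<close> come
    from a choice, so their local boundedness has to be proved.\<close>
  define \<delta> where "\<delta> = (\<lambda>w. 1 / (2 * C w * B))"
  have \<delta>: "\<delta> w > 0" for w
    using C(1) B(1) by (simp add: \<delta>_def)
  have local_bound: "norm (R w u) \<le> 2 * C w0 * norm u" if "w \<in> ball w0 (\<delta> w0)" for w w0 u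
  proof -
    let ?v = "R w u"
    have "?v - w0 *\<^sub>C M ?v = u + (w - w0) *\<^sub>C M ?v"
      using R_right[of w u] by (simp add: cvec.scale_left_diff_distrib algebra_simps)
    then have "?v = R w0 (u + (w - w0) *\<^sub>C M ?v)"
      using R_left[of w0 ?v] by simp
    then have "norm ?v \<le> C w0 * norm (u + (w - w0) *\<^sub>C M ?v)"
      using C(2) by metis
    also have "\<dots> \<le> C w0 * (norm u + \<delta> w0 * (B * norm ?v))"
    proof (intro mult_left_mono order_trans[OF norm_triangle_ineq] add_left_mono)
      have "norm (w - w0) \<le> \<delta> w0"
        using that by (simp add: dist_norm norm_minus_commute)
      then show "norm ((w - w0) *\<^sub>C M ?v) \<le> \<delta> w0 * (B * norm ?v)"
        unfolding norm_scaleC by (intro mult_mono B(2)) (use B \<delta>[of w0] in auto)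
    qed (use C(1)[of w0] in auto)
    also have "\<dots> = C w0 * norm u + norm ?v / 2"
      using C(1)[of w0] B(1) by (simp add: \<delta>_def field_simps)
    finally show ?thesis
      by simp
  qed
  \<comment> \<open>The resolvent identity; with the local bound it gives continuity in
    \<open>w\<close>, and then the derivative.\<close>
  have diff: "R w x - R w0 x = (w - w0) *\<^sub>C R w (M (R w0 x))" for w w0 x
  proof -
    let ?v = "R w0 x"
    have "?v - w *\<^sub>C M ?v = x - (w - w0) *\<^sub>C M ?v"
      using R_right[of w0 x] by (simp add: cvec.scale_left_diff_distrib algebra_simps)
    then have "?v = R w x - (w - w0) *\<^sub>C R w (M ?v)"
      using R_left[of w ?v]
      by (simp add: bounded_clinear_diff[OF R(1)] bounded_clinear_scaleC[OF R(1)])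
    then show ?thesis
      by (simp add: algebra_simps)
  qed
  have lim: "((\<lambda>w. R w x) \<longlongrightarrow> R w0 x) (at w0)" for w0 x
  proof (rule LIM_zero_cancel, rule Lim_null_comparison)
    show "\<forall>\<^sub>F w in at w0. norm (R w x - R w0 x) \<le> norm (w - w0) * (2 * C w0 * norm (M (R w0 x)))"
    proof (rule eventually_at_ball'[OF \<delta>[of w0], THEN eventually_mono])
      fix w
      assume "w \<in> ball w0 (\<delta> w0) \<and> w \<noteq> w0 \<and> w \<in> UNIV"
      then show "norm (R w x - R w0 x) \<le> norm (w - w0) * (2 * C w0 * norm (M (R w0 x)))"
        unfolding diff norm_scaleC by (intro mult_left_mono local_bound) auto
    qed
    show "((\<lambda>w. norm (w - w0) * (2 * C w0 * norm (M (R w0 x)))) \<longlongrightarrow> 0) (at w0)"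
      by (rule tendsto_eq_intros refl | simp)+
  qed
  have holo: "(\<lambda>w. cinner (R w x) y) holomorphic_on UNIV" for x y
  proof -
    have "((\<lambda>w. cinner (R w x) y) has_field_derivative cinner (R w0 (M (R w0 x))) y) (at w0)" for w0
      unfolding has_field_derivative_iff
    proof (rule Lim_transform_eventually)
      show "((\<lambda>w. cinner (R w (M (R w0 x))) y) \<longlongrightarrow> cinner (R w0 (M (R w0 x))) y) (at w0)"
        by (intro tendsto_cinner lim tendsto_const)
      show "\<forall>\<^sub>F w in at w0. cinner (R w (M (R w0 x))) y
          = (cinner (R w x) y - cinner (R w0 x) y) / (w - w0)"
        by (rule eventually_at_filter[THEN iffD2], rule always_eventually)
           (simp add: cinner_diff_left[symmetric] diff cinner_scaleC_left)
    qed
    then show ?thesis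
      unfolding holomorphic_on_def using field_differentiable_at_within field_differentiable_def by blast
  qed
  have pow_bound: "norm ((M ^^ n) z) \<le> B ^ n * norm z" for n z
  proof (induction n)
    case (Suc n)
    have "norm ((M ^^ Suc n) z) \<le> B * norm ((M ^^ n) z)"
      using B(2) by simp
    also have "\<dots> \<le> B * (B ^ n * norm z)"
      using Suc B(1) by (intro mult_left_mono) auto
    finally show ?case
      by (simp add: mult_ac)
  qed simp
  have coeff: "(deriv ^^ n) (\<lambda>w. cinner (R w x) y) 0 / fact n = cinner ((M ^^ n) x) y" for n x y
  proof -
    \<comment> \<open>The Neumann series cut off after \<open>n\<close> terms, with its exact
      remainder.\<close>
    have partial: "R w x = (\<Sum>k<n. w ^ k *\<^sub>C (M ^^ k) x) + w ^ n *\<^sub>C (M ^^ n) (R w x)" for n w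
    proof (induction n)
      case (Suc n)
      have lin: "(M ^^ n) (u + c *\<^sub>C v) = (M ^^ n) u + c *\<^sub>C (M ^^ n) v" for u v c
        by (induction n) (simp_all add: bounded_clinear_add[OF M] bounded_clinear_scaleC[OF M])
      have "R w x = x + w *\<^sub>C M (R w x)"
        using R_right[of w x] by (simp add: algebra_simps)
      then have "(M ^^ n) (R w x) = (M ^^ n) x + w *\<^sub>C (M ^^ n) (M (R w x))"
        using lin[of x w "M (R w x)"] by simp
      with Suc show ?case
        by (simp add: scaleC_add_right scaleC_scaleC funpow_Suc_right mult.commute add.assoc del: funpow.simps)
    qed simp
    have "(\<lambda>w. cinner (R w x) y) has_fps_expansion Abs_fps (\<lambda>n. cinner ((M ^^ n) x) y)"
    proof (rule has_fps_expansionI)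
      \<comment> \<open>Convergence near 0 suffices to identify the Taylor coefficients, and there
        the remainder decays geometrically.\<close>
      have "\<forall>\<^sub>F w in nhds 0. w \<in> ball (0::complex) (1 / B)"
        using B(1) by (intro eventually_nhds_in_open) auto
      then show "\<forall>\<^sub>F w in nhds 0. (\<lambda>n. fps_nth (Abs_fps (\<lambda>n. cinner ((M ^^ n) x) y)) n * w ^ n)
          sums cinner (R w x) y"
      proof (rule eventually_mono)
        fix w :: complex
        assume "w \<in> ball 0 (1 / B)"
        then have w: "norm w * B < 1"
          using B(1) by (simp add: field_simps)
        let ?v = "R w x"
        have "(\<lambda>n. w ^ n *\<^sub>C (M ^^ n) ?v) \<longlonglongrightarrow> 0"
        proof (rule Lim_null_comparison)
          show "\<forall>\<^sub>F n in sequentially. norm (w ^ n *\<^sub>C (M ^^ n) ?v) \<le> (norm w * B) ^ n * norm ?v"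
            using pow_bound by (intro always_eventually allI)
              (simp add: norm_scaleC norm_power power_mult_distrib mult.assoc mult_left_mono)
          show "(\<lambda>n. (norm w * B) ^ n * norm ?v) \<longlonglongrightarrow> 0"
            using w B(1) by (intro tendsto_mult_left_zero LIMSEQ_realpow_zero) auto
        qed
        then have "(\<lambda>n. cinner (?v - w ^ n *\<^sub>C (M ^^ n) ?v) y) \<longlonglongrightarrow> cinner (?v - 0) y"
          by (intro tendsto_cinner tendsto_diff tendsto_const)
        moreover have "cinner (?v - w ^ n *\<^sub>C (M ^^ n) ?v) y = (\<Sum>k<n. cinner ((M ^^ k) x) y * w ^ k)" for n
        proof -
          have "?v - w ^ n *\<^sub>C (M ^^ n) ?v = (\<Sum>k<n. w ^ k *\<^sub>C (M ^^ k) x)"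
            using partial[of w n] by (simp add: algebra_simps)
          then show ?thesis
            by (simp add: cinner_sum_left cinner_scaleC_left mult.commute)
        qed
        ultimately show "(\<lambda>n. fps_nth (Abs_fps (\<lambda>n. cinner ((M ^^ n) x) y)) n * w ^ n) sums cinner ?v y"
          by (simp add: sums_def)
      qed
    qed
    from fps_nth_fps_expansion[OF this, of n] show ?thesis
      by simp
  qed
  have decay: "\<exists>K. \<forall>n x. norm ((M ^^ n) x) \<le> K * norm x / r ^ n" if "r > 0" for r
  proof -
    \<comment> \<open>Compactness of the disc turns the local bounds into one bound \<open>K\<close>
      that holds for all \<open>x\<close> at once.\<close>
    have "cball (0::complex) r \<subseteq> (\<Union>w0. ball w0 (\<delta> w0))"
    proof
      fix w :: complex
      show "w \<in> (\<Union>w0. ball w0 (\<delta> w0))"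
        by (rule UN_I[of w]) (simp_all only: UNIV_I centre_in_ball \<delta>)
    qed
    then obtain W where "W \<subseteq> UNIV" and W: "finite W" "cball 0 r \<subseteq> (\<Union>w0\<in>W. ball w0 (\<delta> w0))"
      by (rule compactE_image[OF compact_cball open_ball])
    define K where "K = (\<Sum>w0\<in>W. 2 * C w0)"
    have K: "norm (R w u) \<le> K * norm u" if "w \<in> cball 0 r" for w u
    proof -
      obtain w0 where w0: "w0 \<in> W" "w \<in> ball w0 (\<delta> w0)"
        using W(2) \<open>w \<in> cball 0 r\<close> by blast
      have "2 * C w0 \<le> K"
        unfolding K_def using w0(1) W(1) C(1) by (intro member_le_sum) (auto simp: less_imp_le)
      then show ?thesis
        using local_bound[OF w0(2), of u] by (meson mult_right_mono norm_ge_zero order_trans)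
    qed
    have "norm ((M ^^ n) x) \<le> K * norm x / r ^ n" for n x
    proof (cases "(M ^^ n) x = 0")
      case True
      have "0 \<le> K"
        unfolding K_def using C(1) by (intro sum_nonneg) (simp add: less_imp_le)
      with True that show ?thesis
        by simp
    next
      case False
      let ?y = "(M ^^ n) x"
      \<comment> \<open>Pairing with \<open>(M ^^ n) x\<close> itself makes the \<open>n\<close>-th
        Taylor coefficient the squared norm of that vector.\<close>
      let ?g = "\<lambda>w. cinner (R w x) ?y"
      have "norm ((deriv ^^ n) ?g 0) \<le> fact n * (K * norm x * norm ?y) / r ^ n"
      proof (rule Cauchy_inequality)
        show "?g holomorphic_on ball 0 r"
          by (rule holomorphic_on_subset[OF holo]) auto
        show "continuous_on (cball 0 r) ?g"
          by (rule continuous_on_subset[OF holomorphic_on_imp_continuous_on[OF holo]]) auto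
        fix w :: complex
        assume "norm (0 - w) = r"
        then have "norm (R w x) \<le> K * norm x"
          by (intro K) simp
        then show "norm (?g w) \<le> K * norm x * norm ?y"
          by (meson mult_right_mono norm_cinner_le norm_ge_zero order_trans)
      qed (rule that)
      then have "norm ((deriv ^^ n) ?g 0 / fact n) \<le> K * norm x * norm ?y / r ^ n"
        by (simp add: norm_divide divide_le_eq mult_ac)
      then have "norm ?y * norm ?y \<le> norm ?y * (K * norm x / r ^ n)"
        unfolding coeff norm_cinner_self by (simp add: power2_eq_square mult_ac)
      then show ?thesis
        by (rule mult_left_le_imp_le) (use False in simp)
    qed
    then show ?thesis
      by blast
  qed
  have unit: "M x = 0" if "norm x = 1" for x
  proof (rule ccontr)
    assume "M x \<noteq> 0"
    define s where "s = norm (M x)"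
    have s: "s > 0"
      using \<open>M x \<noteq> 0\<close> by (simp add: s_def)
    \<comment> \<open>With radius \<open>2 / s\<close> the decay and the growth \<open>s ^ n\<close>
      together give \<open>2 ^ n \<le> K\<close> for every \<open>n\<close>.\<close>
    then obtain K where K: "\<And>n x. norm ((M ^^ n) x) \<le> K * norm x / (2 / s) ^ n"
      using decay[of "2 / s"] by auto
    have "2 ^ n \<le> K" for n
    proof -
      have "s ^ n \<le> norm ((M ^^ n) x)"
        unfolding s_def by (rule normal_orbit_growth[OF A that])
      also have "\<dots> \<le> K / (2 / s) ^ n"
        using K[of n x] that by simp
      finally show ?thesis
        using s by (simp add: field_simps)
    qed
    moreover obtain n where "K < 2 ^ n"
      using real_arch_pow[of 2 K] by auto
    ultimately show False
      using linorder_not_less by blast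
  qed
  show ?thesis
  proof (cases "x = 0")
    case True
    then show ?thesis
      by (simp add: bounded_clinear_zero[OF M])
  next
    case False
    have "M (complex_of_real (1 / norm x) *\<^sub>C x) = 0"
      using False by (intro unit) (simp add: norm_scaleC norm_divide)
    then show ?thesis
      using False by (simp add: bounded_clinear_scaleC[OF M])
  qed
qed

subsection \<open>Spectral resolution\<close>

text \<open>Since \<open>N - l\<close> is normal with adjoint \<open>A - cnj l\<close>, the two
  operators have the same norm at every vector, hence the same kernel.\<close>

lemma normal_eigenvector_adjoint:
  assumes N: "bounded_clinear N" and A: "is_adjoint N A" "\<And>x. N (A x) = A (N x)"
    and x: "N x = l *\<^sub>C x"
  shows "A x = cnj l *\<^sub>C x"
proof -
  have A': "bounded_clinear A"
    by (rule bounded_clinear_adjoint[OF A(1) N])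
  have "norm (A x - cnj l *\<^sub>C x) = norm (N x - l *\<^sub>C x)"
  proof (rule normal_norm_adjoint[where M = "\<lambda>x. N x - l *\<^sub>C x" and A = "\<lambda>x. A x - cnj l *\<^sub>C x"])
    show "is_adjoint (\<lambda>x. N x - l *\<^sub>C x) (\<lambda>x. A x - cnj l *\<^sub>C x)"
      using A(1) by (simp add: is_adjoint_def cinner_diff_left cinner_diff_right
          cinner_scaleC_left cinner_scaleC_right)
  qed (simp add: bounded_clinear_diff[OF N] bounded_clinear_scaleC[OF N] bounded_clinear_diff[OF A']
        bounded_clinear_scaleC[OF A'] A(2) cvec.scale_right_diff_distrib scaleC_scaleC
        mult.commute algebra_simps)
  with x show ?thesis
    by simp
qed

lemma normal_eigenvectors_orthogonal:
  assumes N: "bounded_clinear N" and A: "is_adjoint N A" "\<And>x. N (A x) = A (N x)"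
    and "N x = l *\<^sub>C x" "N y = k *\<^sub>C y" "l \<noteq> k"
  shows "cinner x y = 0"
proof -
  have "l * cinner x y = cinner (N x) y"
    by (simp add: assms(4) cinner_scaleC_left)
  also have "\<dots> = cinner x (A y)"
    using A(1) by (simp add: is_adjoint_def)
  also have "\<dots> = k * cinner x y"
    using normal_eigenvector_adjoint[OF N A assms(5)] by (simp add: cinner_scaleC_right)
  finally show ?thesis
    using assms(6) by simp
qed

text \<open>The adjoint is the polynomial in \<open>A\<close> with conjugate coefficients. The
  induction keeps only that it commutes with \<open>N\<close>, from which commutation with the
  polynomial follows.\<close>

lemma poly_op_adjoint:
  assumes N: "bounded_clinear N" and A: "is_adjoint N A" "\<And>x. N (A x) = A (N x)"
  obtains S where "is_adjoint (poly_op N p) S" "\<And>x. poly_op N p (S x) = S (poly_op N p x)"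
proof -
  have "\<exists>S. is_adjoint (poly_op N p) S \<and> (\<forall>x. S (N x) = N (S x))"
  proof (induction p)
    case 0
    show ?case
      by (intro exI[of _ "\<lambda>x. 0"]) (simp add: is_adjoint_def bounded_clinear_zero[OF N])
  next
    case (pCons a p)
    then obtain S where S: "is_adjoint (poly_op N p) S" "\<And>x. S (N x) = N (S x)"
      by blast
    show ?case
    proof (intro exI conjI allI)
      show "is_adjoint (poly_op N (pCons a p)) (\<lambda>x. cnj a *\<^sub>C x + A (S x))"
        using S(1) A(1) by (simp add: is_adjoint_def cinner_add_left cinner_add_right
            cinner_scaleC_left cinner_scaleC_right)
      show "cnj a *\<^sub>C N x + A (S (N x)) = N (cnj a *\<^sub>C x + A (S x))" for x
        by (simp add: bounded_clinear_add[OF N] bounded_clinear_scaleC[OF N] S(2) A(2))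
    qed
  qed
  then obtain S where S: "is_adjoint (poly_op N p) S" "\<And>x. S (N x) = N (S x)"
    by blast
  have "bounded_clinear S"
    by (rule bounded_clinear_adjoint[OF S(1) bounded_clinear_poly_op[OF N]])
  then show thesis
    using S poly_op_commute[of S N] by (intro that[of S]) auto
qed

text \<open>Distinct simple roots make the kernel of the product the sum of the eigenspaces.
  Inductively \<open>T x - m *\<^sub>C x\<close> decomposes over \<open>F\<close>; dividing its
  components by \<open>l - m\<close> and subtracting them from \<open>x\<close> leaves an
  eigenvector for \<open>m\<close>.\<close>

lemma poly_op_vanishing_decomposition:
  assumes T: "bounded_clinear T" and "finite F" "poly_op T (\<Prod>l\<in>F. [:- l, 1:]) x = 0"
  shows "\<exists>y. (\<forall>l. T (y l) = l *\<^sub>C y l) \<and> (\<forall>l. l \<notin> F \<longrightarrow> y l = 0) \<and> (\<Sum>l\<in>F. y l) = x"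
  using assms(2,3)
proof (induction F arbitrary: x)
  case empty
  then have "x = 0"
    by (simp add: one_pCons)
  then show ?case
    by (intro exI[of _ "\<lambda>l. 0"]) (simp add: bounded_clinear_zero[OF T])
next
  case (insert m F)
  have "poly_op T (\<Prod>l\<in>F. [:- l, 1:]) (T x - m *\<^sub>C x) = poly_op T ((\<Prod>l\<in>F. [:- l, 1:]) * [:- m, 1:]) x"
    by (simp only: poly_op_mult[OF T]) (simp add: cvec.scale_minus_left)
  also have "(\<Prod>l\<in>F. [:- l, 1:]) * [:- m, 1:] = (\<Prod>l\<in>insert m F. [:- l, 1:])"
    by (simp only: prod.insert[OF insert(1,2)] mult.commute)
  also have "poly_op T \<dots> x = 0"
    by (rule insert.prems)
  finally obtain y where y: "\<And>l. T (y l) = l *\<^sub>C y l" "\<And>l. l \<notin> F \<Longrightarrow> y l = 0"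
      "(\<Sum>l\<in>F. y l) = T x - m *\<^sub>C x"
    using insert.IH by blast
  define z where "z = (\<lambda>l. inverse (l - m) *\<^sub>C y l)"
  define w where "w = x - (\<Sum>l\<in>F. z l)"
  have z: "T (z l) = l *\<^sub>C z l" for l
    by (simp add: z_def bounded_clinear_scaleC[OF T] y scaleC_scaleC mult.commute)
  have "T (z l) - m *\<^sub>C z l = y l" if "l \<in> F" for l
  proof -
    have "l \<noteq> m"
      using that insert by auto
    have "T (z l) - m *\<^sub>C z l = (l - m) *\<^sub>C z l"
      unfolding z by (simp add: cvec.scale_left_diff_distrib)
    also have "\<dots> = y l"
      using \<open>l \<noteq> m\<close> by (simp add: z_def scaleC_scaleC)
    finally show ?thesis .
  qed
  then have "(\<Sum>l\<in>F. T (z l) - m *\<^sub>C z l) = T x - m *\<^sub>C x"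
    using y(3) by simp
  then have "T w - m *\<^sub>C w = 0"
    by (simp add: w_def bounded_clinear_diff[OF T] bounded_clinear_sum[OF T]
        cvec.scale_right_diff_distrib cvec.scale_sum_right sum_subtractf algebra_simps)
  then have w: "T w = m *\<^sub>C w"
    by simp
  show ?case
  proof (intro exI[of _ "z(m := w)"] conjI allI impI)
    show "T ((z(m := w)) l) = l *\<^sub>C (z(m := w)) l" for l
      using z w by simp
    show "(z(m := w)) l = 0" if "l \<notin> insert m F" for l
      using that y(2) by (auto simp: z_def)
    have "(\<Sum>l\<in>F. (z(m := w)) l) = (\<Sum>l\<in>F. z l)"
      using insert by (intro sum.cong) auto
    then show "(\<Sum>l\<in>insert m F. (z(m := w)) l) = x"
      using insert by (simp add: w_def)
  qed
qed

text \<open>\<open>P\<close> is defined at every complex number. Idempotence and mutual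
  orthogonality follow from the two eigenvector rules, because \<open>P k x\<close> is itself an
  eigenvector for \<open>k\<close>.\<close>

locale spectral_resolution =
  fixes N :: "'a::chilbert_space \<Rightarrow> 'a" and \<Lambda> :: "complex set" and P :: "complex \<Rightarrow> 'a \<Rightarrow> 'a"
  assumes bounded_N: "bounded_clinear N"
    and finite_\<Lambda>: "finite \<Lambda>"
    and bounded_P: "bounded_clinear (P l)"
    and N_P: "N (P l x) = l *\<^sub>C P l x"
    and sum_P: "(\<Sum>l\<in>\<Lambda>. P l x) = x"
    and P_eigenvector: "N x = l *\<^sub>C x \<Longrightarrow> P l x = x"
    and P_eigenvector_other: "N x = k *\<^sub>C x \<Longrightarrow> l \<noteq> k \<Longrightarrow> P l x = 0"
    and P_selfadjoint: "cinner (P l x) y = cinner x (P l y)"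

text \<open>
  Including 0 in the index set makes the polynomial with these roots nonconstant without knowing
  that the spectrum is nonempty; the corresponding projection may vanish.
\<close>

lemma normal_spectral_resolution:
  fixes N :: "'a::chilbert_space \<Rightarrow> 'a"
  assumes N: "bounded_clinear N" and A: "is_adjoint N A" "\<And>x. N (A x) = A (N x)"
    and fin: "finite (op_spectrum N)"
  obtains P where "spectral_resolution N (insert 0 (op_spectrum N)) P"
proof -
  define \<Lambda> where "\<Lambda> = insert 0 (op_spectrum N)"
  have fin': "finite \<Lambda>"
    using fin by (simp add: \<Lambda>_def)
  define p where "p = (\<Prod>l\<in>\<Lambda>. [:- l, 1:])"
  have root: "poly p z = 0 \<longleftrightarrow> z \<in> \<Lambda>" for z
    using fin' by (auto simp: p_def poly_prod)
  \<comment> \<open>As \<open>p\<close> vanishes on the spectrum, \<open>1 - smult w p\<close>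
    equals 1 there, so the operator \<open>1 - w p(N)\<close> is invertible for every
    \<open>w\<close>: \<open>p(N)\<close> is quasinilpotent.\<close>
  have pN: "poly_op N p x = 0" for x
  proof -
    obtain S where S: "is_adjoint (poly_op N p) S" "\<And>x. poly_op N p (S x) = S (poly_op N p x)"
      using poly_op_adjoint[OF N A] by blast
    show ?thesis
    proof (rule normal_quasinilpotent_zero[OF bounded_clinear_poly_op[OF N] S])
      fix w
      have "poly (1 - smult w p) 0 = 1"
        using root[of 0] by (simp add: \<Lambda>_def)
      then have "1 - smult w p \<noteq> 0"
        by (metis poly_0 zero_neq_one)
      moreover have "z \<notin> op_spectrum N" if "poly (1 - smult w p) z = 0" for z
        using that root[of z] by (auto simp: \<Lambda>_def)
      ultimately have "cinvertible (poly_op N (1 - smult w p))"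
        by (intro cinvertible_poly_op N)
      moreover have "poly_op N (1 - smult w p) = (\<lambda>x. x - w *\<^sub>C poly_op N p x)"
      proof
        fix x
        show "poly_op N (1 - smult w p) x = x - w *\<^sub>C poly_op N p x"
          using poly_op_add[of N 1 "smult (- w) p" x]
          by (simp add: poly_op_smult[of N "- w", simplified] one_pCons cvec.scale_minus_left)
      qed
      ultimately show "cinvertible (\<lambda>x. x - w *\<^sub>C poly_op N p x)"
        by simp
    qed
  qed
  have "\<forall>x. \<exists>y. (\<forall>l. N (y l) = l *\<^sub>C y l) \<and> (\<forall>l. l \<notin> \<Lambda> \<longrightarrow> y l = 0) \<and> (\<Sum>l\<in>\<Lambda>. y l) = x"
    using poly_op_vanishing_decomposition[OF N fin'] pN unfolding p_def by blast
  then obtain Q where Q: "\<And>x l. N (Q x l) = l *\<^sub>C Q x l" "\<And>x l. l \<notin> \<Lambda> \<Longrightarrow> Q x l = 0"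
      "\<And>x. (\<Sum>l\<in>\<Lambda>. Q x l) = x"
    by metis
  note orth = normal_eigenvectors_orthogonal[OF N A]
  \<comment> \<open>\<open>Q\<close> was only chosen; linearity and the eigenvector rules are read
    off from uniqueness. The difference of two decompositions has orthogonal components with sum
    zero, so Pythagoras kills each of them.\<close>
  have uniq: "Q x l = z l" if z: "\<And>l. N (z l) = l *\<^sub>C z l" "\<And>l. l \<notin> \<Lambda> \<Longrightarrow> z l = 0" "(\<Sum>l\<in>\<Lambda>. z l) = x" for x z l
  proof (cases "l \<in> \<Lambda>")
    case True
    have eig: "N (Q x l - z l) = l *\<^sub>C (Q x l - z l)" for l
      by (simp add: bounded_clinear_diff[OF N] Q(1) z(1) cvec.scale_right_diff_distrib)
    have "(norm (\<Sum>l\<in>\<Lambda>. Q x l - z l))\<^sup>2 = (\<Sum>l\<in>\<Lambda>. (norm (Q x l - z l))\<^sup>2)"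
      by (intro norm_sum_square fin' orth[OF eig eig])
    then have "(\<Sum>l\<in>\<Lambda>. (norm (Q x l - z l))\<^sup>2) = 0"
      by (simp add: sum_subtractf Q(3) z(3))
    then show ?thesis
      using True fin' by (simp add: sum_nonneg_eq_0_iff)
  qed (simp add: Q z)
  have zero: "x = 0" if "N x = l *\<^sub>C x" "l \<notin> \<Lambda>" for x l
  proof -
    have "cinner (\<Sum>k\<in>\<Lambda>. Q x k) x = 0"
      unfolding cinner_sum_left
      by (intro sum.neutral ballI orth[OF Q(1) that(1)]) (use that in auto)
    then show ?thesis
      by (simp add: Q(3))
  qed
  have single: "Q x k = (if k = l then x else 0)" if "N x = l *\<^sub>C x" for x l k
  proof (rule uniq)
    show "N (if j = l then x else 0) = j *\<^sub>C (if j = l then x else 0)" for j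
      using that by (simp add: bounded_clinear_zero[OF N])
    show "(if j = l then x else 0) = 0" if "j \<notin> \<Lambda>" for j
      using zero[OF \<open>N x = l *\<^sub>C x\<close>] that by auto
    show "(\<Sum>j\<in>\<Lambda>. if j = l then x else 0) = x"
      using zero[OF that] fin' by auto
  qed
  have "spectral_resolution N \<Lambda> (\<lambda>l x. Q x l)"
  proof
    show "bounded_clinear (\<lambda>x. Q x l)" for l
    proof (rule bounded_clinearI[of _ 1])
      show "Q (x + y) l = Q x l + Q y l" for x y
        by (rule uniq)
           (simp_all add: Q bounded_clinear_add[OF N] scaleC_add_right sum.distrib)
      show "Q (c *\<^sub>C x) l = c *\<^sub>C Q x l" for c x
        by (rule uniq)
           (simp_all add: Q bounded_clinear_scaleC[OF N] scaleC_scaleC mult.commute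
             flip: cvec.scale_sum_right)
      show "norm (Q x l) \<le> norm x * 1" for x
      proof (cases "l \<in> \<Lambda>")
        case True
        have "(norm (Q x l))\<^sup>2 \<le> (\<Sum>l\<in>\<Lambda>. (norm (Q x l))\<^sup>2)"
          using True fin' by (intro member_le_sum) auto
        also have "\<dots> = (norm (\<Sum>l\<in>\<Lambda>. Q x l))\<^sup>2"
          by (intro norm_sum_square[symmetric] fin' orth[OF Q(1) Q(1)])
        finally show ?thesis
          by (simp add: Q(3) power2_le_iff_abs_le)
      qed (simp add: Q)
    qed
    show "cinner (Q x l) y = cinner x (Q y l)" for l x y
    proof (cases "l \<in> \<Lambda>")
      case True
      have "cinner (Q x l) y = cinner (Q x l) (\<Sum>k\<in>\<Lambda>. Q y k)"
        by (simp add: Q(3))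
      also have "\<dots> = (\<Sum>k\<in>\<Lambda>. if k = l then cinner (Q x l) (Q y l) else 0)"
        unfolding cinner_sum_right by (intro sum.cong refl) (use orth[OF Q(1) Q(1)] in auto)
      also have "\<dots> = (\<Sum>k\<in>\<Lambda>. cinner (Q x k) (Q y l))"
        by (intro sum.cong refl) (use orth[OF Q(1) Q(1)] in auto)
      also have "\<dots> = cinner x (Q y l)"
        by (simp add: Q(3) flip: cinner_sum_left)
      finally show ?thesis .
    qed (simp add: Q(2))
    show "Q x l = x" if "N x = l *\<^sub>C x" for l x
      using single[OF that, of l] by simp
    show "Q x l = 0" if "N x = k *\<^sub>C x" "l \<noteq> k" for k l x
      using single[OF that(1), of l] that(2) by simp
  qed (simp_all add: N fin' Q)
  then show thesis
    using that by (simp add: \<Lambda>_def)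
qed

context spectral_resolution
begin

lemma P_P: "P l (P k x) = (if l = k then P k x else 0)"
  using P_eigenvector[OF N_P] P_eigenvector_other[OF N_P] by auto

lemma norm_P_le: "norm (P l x) \<le> norm x"
proof -
  have "(norm (P l x))\<^sup>2 = norm (cinner x (P l x))"
    by (simp add: norm_cinner_self[symmetric] P_selfadjoint P_P)
  also have "\<dots> \<le> norm x * norm (P l x)"
    by (rule norm_cinner_le)
  finally show ?thesis
    by (cases "norm (P l x) = 0") (auto simp: power2_eq_square)
qed

lemma cinner_P: "cinner (P l x) x = complex_of_real ((norm (P l x))\<^sup>2)"
  unfolding cinner_self[symmetric] P_selfadjoint P_P by simp

lemma norm_square_sum_P: "(\<Sum>l\<in>\<Lambda>. (norm (P l x))\<^sup>2) = (norm x)\<^sup>2"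
proof -
  have "(norm (\<Sum>l\<in>\<Lambda>. P l x))\<^sup>2 = (\<Sum>l\<in>\<Lambda>. (norm (P l x))\<^sup>2)"
    by (intro norm_sum_square finite_\<Lambda>) (simp add: P_selfadjoint P_P)
  then show ?thesis
    by (simp add: sum_P)
qed

lemma cinner_N: "cinner (N x) x = (\<Sum>l\<in>\<Lambda>. l * complex_of_real ((norm (P l x))\<^sup>2))"
proof -
  have "cinner (N x) x = cinner (N (\<Sum>l\<in>\<Lambda>. P l x)) x"
    by (simp add: sum_P)
  also have "\<dots> = (\<Sum>l\<in>\<Lambda>. l * cinner (P l x) x)"
    by (simp add: bounded_clinear_sum[OF bounded_N] N_P cinner_sum_left cinner_scaleC_left)
  finally show ?thesis
    by (simp add: cinner_P)
qed

lemma P_outside: "l \<notin> \<Lambda> \<Longrightarrow> P l x = 0"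
proof -
  assume l: "l \<notin> \<Lambda>"
  have "P l x = (\<Sum>k\<in>\<Lambda>. P l (P k x))"
    by (simp add: sum_P flip: bounded_clinear_sum[OF bounded_P])
  also have "\<dots> = 0"
    using l by (intro sum.neutral) (auto simp: P_P)
  finally show ?thesis .
qed

lemma sum_P_minus: "(\<Sum>k\<in>\<Lambda> - {l}. P k x) = x - P l x"
proof (cases "l \<in> \<Lambda>")
  case True
  then show ?thesis
    using sum_P[of x] sum.remove[OF finite_\<Lambda> True, of "\<lambda>k. P k x"] by (simp add: algebra_simps)
next
  case False
  then show ?thesis
    using sum_P[of x] by (simp add: P_outside)
qed

lemma norm_minus_P: "(norm (x - P l x))\<^sup>2 = (\<Sum>k\<in>\<Lambda> - {l}. (norm (P k x))\<^sup>2)"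
  unfolding sum_P_minus[symmetric]
  by (intro norm_sum_square) (simp_all add: finite_\<Lambda> P_selfadjoint P_P)

end

section \<open>The essential spectrum\<close>

text \<open>\<open>V\<close> is only closed under scalars: it will also be a union of eigenspaces,
  which is no subspace. A family of greatest cardinality works, since a nonzero vector orthogonal to
  it could be normalized and added.\<close>

lemma maximal_orthonormal:
  fixes V :: "'a::complex_inner set"
  assumes bound: "\<And>B. finite B \<Longrightarrow> B \<subseteq> V \<Longrightarrow> orthonormal_on B (\<lambda>x. x) \<Longrightarrow> card B \<le> k"
    and scale: "\<And>c x. x \<in> V \<Longrightarrow> c *\<^sub>C x \<in> V"
  obtains B where "finite B" "B \<subseteq> V" "orthonormal_on B (\<lambda>x. x)"
    "\<forall>x\<in>V. (\<forall>b\<in>B. cinner x b = 0) \<longrightarrow> x = 0"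
proof -
  let ?Q = "\<lambda>B. finite B \<and> B \<subseteq> V \<and> orthonormal_on B (\<lambda>x. x)"
  have "?Q {}"
    by (simp add: orthonormal_on_def)
  moreover have "\<forall>B. ?Q B \<longrightarrow> card B < Suc k"
    using bound by (simp add: less_Suc_eq_le)
  ultimately obtain B where B: "?Q B" "\<And>C. ?Q C \<Longrightarrow> card C \<le> card B"
    using ex_has_greatest_nat[of ?Q "{}" card "Suc k"] by auto
  have "x = 0" if x: "x \<in> V" "\<And>b. b \<in> B \<Longrightarrow> cinner x b = 0" for x
  proof (rule ccontr)
    assume "x \<noteq> 0"
    define u where "u = complex_of_real (1 / norm x) *\<^sub>C x"
    have "norm u = 1"
      using \<open>x \<noteq> 0\<close> by (simp add: u_def norm_scaleC norm_divide)
    then have u: "u \<in> V" "cinner u u = 1" "\<And>b. b \<in> B \<Longrightarrow> cinner u b = 0"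
      using x scale by (simp_all add: u_def cinner_scaleC_left cinner_self)
    then have u': "cinner b u = 0" if "b \<in> B" for b
      using that by (simp only: cinner_eq_zero_commute[of b])
    have "u \<notin> B"
      using u by auto
    have "?Q (insert u B)"
      using B(1) u u' \<open>u \<notin> B\<close> by (auto simp: orthonormal_on_def)
    from B(2)[OF this] show False
      using B(1) \<open>u \<notin> B\<close> by simp
  qed
  then show thesis
    using that[of B] B(1) by blast
qed

text \<open>On the eigenspace the compact operator \<open>S (T x - l *\<^sub>C x) - x\<close> is
  minus the identity, so a finite net of its image bounds the size of orthonormal sets of
  eigenvectors.\<close>

lemma not_essential_card_bound:
  fixes T :: "'a::chilbert_space \<Rightarrow> 'a"
  assumes "l \<notin> essential_spectrum T"
  shows "\<exists>k. \<forall>B. finite B \<longrightarrow> B \<subseteq> {x. T x = l *\<^sub>C x} \<longrightarrow> orthonormal_on B (\<lambda>x. x) \<longrightarrow> card B \<le> k"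
proof -
  obtain S where S: "bounded_clinear S" "compact_op (\<lambda>x. S (T x - l *\<^sub>C x) - x)"
    using assms by (auto simp: essential_spectrum_def)
  let ?C = "\<lambda>x. S (T x - l *\<^sub>C x) - x"
  have "\<forall>\<epsilon>>0. \<exists>K. finite K \<and> closure (?C ` cball 0 1) \<subseteq> (\<Union>x\<in>K. ball x \<epsilon>)"
    using S(2) unfolding compact_op_def compact_eq_totally_bounded by (elim conjE)
  \<comment> \<open>Points of a common ball of radius 1/2 are less than 1 apart, while orthonormal
    vectors have squared distance 2.\<close>
  then have "\<exists>K. finite K \<and> closure (?C ` cball 0 1) \<subseteq> (\<Union>x\<in>K. ball x (1 / 2))"
    by (rule allE[of _ "1 / 2"]) simp
  then obtain K where K: "finite K" "closure (?C ` cball 0 1) \<subseteq> (\<Union>x\<in>K. ball x (1 / 2))"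
    by (elim exE conjE)
  have "card B \<le> card K" if B: "finite B" "B \<subseteq> {x. T x = l *\<^sub>C x}" "orthonormal_on B (\<lambda>x. x)" for B
  proof -
    have "\<exists>x\<in>K. - b \<in> ball x (1 / 2)" if "b \<in> B" for b
    proof -
      have "- b = ?C b"
        using that B(2) by (auto simp: bounded_clinear_zero[OF S(1)])
      moreover have "b \<in> cball 0 1"
        using orthonormal_on_norm[OF B(3) that] by simp
      ultimately have "- b \<in> ?C ` cball 0 1"
        by (rule image_eqI)
      then have "- b \<in> closure (?C ` cball 0 1)"
        by (rule subsetD[OF closure_subset])
      with K(2) show ?thesis
        by blast
    qed
    then obtain g where g: "\<And>b. b \<in> B \<Longrightarrow> g b \<in> K \<and> - b \<in> ball (g b) (1 / 2)"
      by metis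
    have "inj_on g B"
    proof (rule inj_onI, rule ccontr)
      fix b c
      assume bc: "b \<in> B" "c \<in> B" "g b = g c" "b \<noteq> c"
      have "dist (- b) (- c) \<le> dist (g b) (- b) + dist (g b) (- c)"
        by (rule dist_triangle3)
      also have "\<dots> < 1 / 2 + 1 / 2"
        using g[OF bc(1)] g[OF bc(2)] bc(3) by (intro add_strict_mono) auto
      finally have "norm (c - b) < 1"
        by (simp add: dist_norm)
      moreover have "(norm (c + - b))\<^sup>2 = (norm c)\<^sup>2 + (norm (- b))\<^sup>2"
      proof (rule norm_add_square)
        have "cinner (- b) c = 0"
          using orthonormal_onD[OF B(3) bc(1,2)] bc(4) by (simp add: cinner_minus_left)
        then show "cinner c (- b) = 0"
          by (simp only: cinner_eq_zero_commute[of c])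
      qed
      ultimately show False
        using orthonormal_on_norm[OF B(3) bc(1)] orthonormal_on_norm[OF B(3) bc(2)]
          power_strict_mono[of "norm (c - b)" 1 2] by simp
    qed
    then show ?thesis
      using g K(1) by (intro card_inj_on_le[of g]) auto
  qed
  then show ?thesis
    by blast
qed

lemma compact_lincombs:
  fixes B :: "'a::complex_inner set"
  assumes "finite B"
  shows "\<exists>K. compact K \<and> (\<forall>c. (\<forall>b\<in>B. norm (c b) \<le> 1) \<longrightarrow> (\<Sum>b\<in>B. c b *\<^sub>C b) \<in> K)"
  using assms
proof induction
  case empty
  show ?case
    by (intro exI[of _ "{0}"]) simp
next
  case (insert b B)
  then obtain K where K: "compact K" "\<And>c. (\<forall>b\<in>B. norm (c b) \<le> 1) \<Longrightarrow> (\<Sum>b\<in>B. c b *\<^sub>C b) \<in> K"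
    by blast
  let ?L = "(\<lambda>z. z *\<^sub>C b) ` cball 0 1"
  have "compact ?L"
    by (intro compact_continuous_image compact_cball
        bounded_bilinear.continuous_on[OF bounded_bilinear_scaleC] continuous_intros)
  then have "compact {x + y |x y. x \<in> ?L \<and> y \<in> K}"
    using K(1) by (rule compact_sums)
  moreover have "(\<Sum>b\<in>insert b B. c b *\<^sub>C b) \<in> {x + y |x y. x \<in> ?L \<and> y \<in> K}"
    if "\<forall>b\<in>insert b B. norm (c b) \<le> 1" for c
  proof -
    have "c b *\<^sub>C b \<in> ?L"
      using that by (intro imageI) simp
    moreover have "(\<Sum>b\<in>B. c b *\<^sub>C b) \<in> K"
      using that by (intro K(2)) simp
    ultimately show ?thesis
      using insert by auto
  qed
  ultimately show ?case
    by blast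
qed

section \<open>Essential spectral values as eigenvalues of infinite multiplicity\<close>

context spectral_resolution
begin

lemma P_finite_rank:
  assumes "\<And>B. finite B \<Longrightarrow> B \<subseteq> {x. N x = l *\<^sub>C x} \<Longrightarrow> orthonormal_on B (\<lambda>x. x) \<Longrightarrow> card B \<le> k"
  obtains B where "finite B" "orthonormal_on B (\<lambda>x. x)" "P l = (\<lambda>x. \<Sum>b\<in>B. cinner x b *\<^sub>C b)"
proof -
  have scale: "c *\<^sub>C x \<in> {x. N x = l *\<^sub>C x}" if "x \<in> {x. N x = l *\<^sub>C x}" for c x
    using that by (simp add: bounded_clinear_scaleC[OF bounded_N] scaleC_scaleC mult.commute)
  obtain B where B: "finite B" "B \<subseteq> {x. N x = l *\<^sub>C x}" "orthonormal_on B (\<lambda>x. x)"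
    "\<forall>x\<in>{x. N x = l *\<^sub>C x}. (\<forall>b\<in>B. cinner x b = 0) \<longrightarrow> x = 0"
    by (rule maximal_orthonormal[OF assms scale])
  have "P l x = (\<Sum>b\<in>B. cinner x b *\<^sub>C b)" for x
  proof -
    have coeff: "cinner (P l x) b = cinner x b" if "b \<in> B" for b
      using that B(2) P_eigenvector[of b l] by (auto simp: P_selfadjoint)
    let ?y = "P l x - (\<Sum>b\<in>B. cinner (P l x) b *\<^sub>C b)"
    have "?y = 0"
    proof (rule B(4)[rule_format])
      have "(\<Sum>b\<in>B. cinner (P l x) b *\<^sub>C N b) = l *\<^sub>C (\<Sum>b\<in>B. cinner (P l x) b *\<^sub>C b)"
        unfolding cvec.scale_sum_right
        by (intro sum.cong refl) (use B(2) in \<open>auto simp: scaleC_scaleC mult.commute\<close>)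
      then show "?y \<in> {x. N x = l *\<^sub>C x}"
        by (simp add: bounded_clinear_diff[OF bounded_N] bounded_clinear_sum[OF bounded_N]
            bounded_clinear_scaleC[OF bounded_N] N_P cvec.scale_right_diff_distrib)
      show "cinner ?y b = 0" if "b \<in> B" for b
        using cinner_diff_proj[OF B(1,3) that] .
    qed
    then show ?thesis
      using coeff by simp
  qed
  then have "P l = (\<lambda>x. \<Sum>b\<in>B. cinner x b *\<^sub>C b)" ..
  with B(1,3) show thesis
    by (rule that)
qed

text \<open>The series is the trace of \<open>P l\<close>, that is, the dimension of the eigenspace.
  Finite dimension makes \<open>P l\<close> compact and \<open>N - l\<close> invertible modulo it;
  conversely an inessential \<open>l\<close> has a finite-rank projection by the net
  argument.\<close>

lemma essential_spectrum_iff: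
  assumes e: "total_orthonormal e"
  shows "l \<in> essential_spectrum N \<longleftrightarrow> \<not> summable (\<lambda>n. (norm (P l (e n)))\<^sup>2)"
proof -
  note on = total_orthonormalD(1)[OF e]
  have "summable (\<lambda>n. (norm (P l (e n)))\<^sup>2)" if not_ess: "l \<notin> essential_spectrum N"
  proof -
    obtain k where "\<And>B. finite B \<Longrightarrow> B \<subseteq> {x. N x = l *\<^sub>C x} \<Longrightarrow> orthonormal_on B (\<lambda>x. x) \<Longrightarrow> card B \<le> k"
      using not_essential_card_bound[OF not_ess] by blast
    then obtain B where B: "finite B" "orthonormal_on B (\<lambda>x. x)"
        "P l = (\<lambda>x. \<Sum>b\<in>B. cinner x b *\<^sub>C b)"
      by (rule P_finite_rank)
    have "(norm (P l (e n)))\<^sup>2 = (\<Sum>b\<in>B. (norm (cinner b (e n)))\<^sup>2)" for n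
      unfolding B(3) norm_lincomb[OF B(1,2)] by (simp add: norm_cinner_commute)
    then show ?thesis
      by (simp add: summable_sum bessel_summable[OF on])
  qed
  moreover have "l \<notin> essential_spectrum N" if summ: "summable (\<lambda>n. (norm (P l (e n)))\<^sup>2)"
  proof -
    define s where "s = (\<Sum>n. (norm (P l (e n)))\<^sup>2)"
    \<comment> \<open>By Parseval \<open>card B\<close> is the double sum of the squared
      coefficients of \<open>B\<close>; summed over \<open>B\<close> first, it is dominated by the
      trace \<open>s\<close> through Bessel's inequality.\<close>
    have "card B \<le> nat \<lceil>s\<rceil>" if B: "finite B" "B \<subseteq> {x. N x = l *\<^sub>C x}" "orthonormal_on B (\<lambda>x. x)" for B
    proof -
      have "(\<Sum>b\<in>B. (norm (cinner b (e n)))\<^sup>2) \<le> (norm (P l (e n)))\<^sup>2" for n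
      proof -
        have "norm (cinner b (e n)) = norm (cinner (P l (e n)) b)" if "b \<in> B" for b
        proof -
          have "P l b = b"
            using that B(2) by (intro P_eigenvector) auto
          then show ?thesis
            by (simp only: P_selfadjoint norm_cinner_commute[of b])
        qed
        then have "(\<Sum>b\<in>B. (norm (cinner b (e n)))\<^sup>2) = (\<Sum>b\<in>B. (norm (cinner (P l (e n)) b))\<^sup>2)"
          by (intro sum.cong refl) (simp only:)
        also have "\<dots> \<le> (norm (P l (e n)))\<^sup>2"
          by (rule bessel[OF B(1,3)])
        finally show ?thesis .
      qed
      moreover have "(\<lambda>n. \<Sum>b\<in>B. (norm (cinner b (e n)))\<^sup>2) sums (\<Sum>b\<in>B. (norm b)\<^sup>2)"
        by (intro sums_sum parseval e)
      ultimately have "(\<Sum>b\<in>B. (norm b)\<^sup>2) \<le> s"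
        unfolding s_def by (rule sums_le[OF _ _ summable_sums[OF summ]])
      moreover have "(\<Sum>b\<in>B. (norm b)\<^sup>2) = (\<Sum>b\<in>B. 1)"
        by (intro sum.cong refl) (simp add: orthonormal_on_norm[OF B(3)])
      ultimately have "card B \<le> s"
        by simp
      then show ?thesis
        by linarith
    qed
    then obtain B where B: "finite B" "orthonormal_on B (\<lambda>x. x)"
        "P l = (\<lambda>x. \<Sum>b\<in>B. cinner x b *\<^sub>C b)"
      by (rule P_finite_rank)
    have compact: "compact_op (\<lambda>x. - P l x)"
      unfolding compact_op_def
    proof
      show "bounded_clinear (\<lambda>x. - P l x)"
        using bounded_clinear_smult[OF bounded_P, of "- 1" l] by (simp add: cvec.scale_minus_left)
      obtain K where K: "compact K" "\<And>c. (\<forall>b\<in>B. norm (c b) \<le> 1) \<Longrightarrow> (\<Sum>b\<in>B. c b *\<^sub>C b) \<in> K"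
        using compact_lincombs[OF B(1)] by blast
      have "(\<lambda>x. - P l x) ` cball 0 1 \<subseteq> K"
      proof safe
        fix x :: 'a
        assume x: "x \<in> cball 0 1"
        have "- P l x = (\<Sum>b\<in>B. (- cinner x b) *\<^sub>C b)"
          by (simp add: B(3) sum_negf cvec.scale_minus_left)
        also have "\<dots> \<in> K"
        proof (intro K(2) ballI)
          fix b
          assume "b \<in> B"
          have "norm (cinner x b) \<le> norm x * norm b"
            by (rule norm_cinner_le)
          with x show "norm (- cinner x b) \<le> 1"
            using orthonormal_on_norm[OF B(2) \<open>b \<in> B\<close>] by simp
        qed
        finally show "- P l x \<in> K" .
      qed
      then have "closure ((\<lambda>x. - P l x) ` cball 0 1) \<subseteq> K"
        by (intro closure_minimal compact_imp_closed K(1))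
      then show "compact (closure ((\<lambda>x. - P l x) ` cball 0 1))"
        using K(1) by (metis closed_closure compact_Int_closed inf.absorb_iff2)
    qed
    \<comment> \<open>The inverse of \<open>N - l\<close> on the other eigenspaces, extended by
      zero; both defects are then exactly \<open>- P l x\<close>.\<close>
    define S where "S = (\<lambda>x. \<Sum>k\<in>\<Lambda> - {l}. inverse (k - l) *\<^sub>C P k x)"
    have "bounded_clinear (\<lambda>x. \<Sum>k\<in>F. inverse (k - l) *\<^sub>C P k x)" if "finite F" for F
      using that
    proof induction
      case (insert k F)
      then show ?case
        by (simp add: bounded_clinear_plus bounded_clinear_smult bounded_P)
    qed (simp add: bounded_clinear_const_zero)
    then have "bounded_clinear S"
      unfolding S_def using finite_\<Lambda> by simp
    moreover have "S (N x - l *\<^sub>C x) - x = - P l x" for x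
    proof -
      have "P k (N x) = k *\<^sub>C P k x" for k
      proof -
        have "P k (N x) = P k (N (\<Sum>j\<in>\<Lambda>. P j x))"
          by (simp add: sum_P)
        also have "\<dots> = (\<Sum>j\<in>\<Lambda>. if j = k then k *\<^sub>C P k x else 0)"
          unfolding bounded_clinear_sum[OF bounded_N] bounded_clinear_sum[OF bounded_P] N_P
          by (intro sum.cong refl) (auto simp: bounded_clinear_scaleC[OF bounded_P] P_P)
        also have "\<dots> = k *\<^sub>C P k x"
          using finite_\<Lambda> by (auto simp: P_outside)
        finally show ?thesis .
      qed
      then have "S (N x - l *\<^sub>C x) = (\<Sum>k\<in>\<Lambda> - {l}. P k x)"
        unfolding S_def
        by (intro sum.cong refl) (simp add: bounded_clinear_diff[OF bounded_P]
            bounded_clinear_scaleC[OF bounded_P] scaleC_scaleC flip: cvec.scale_left_diff_distrib)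
      then show ?thesis
        by (simp add: sum_P_minus)
    qed
    moreover have "(N (S x) - l *\<^sub>C S x) - x = - P l x" for x
    proof -
      have "N (S x) - l *\<^sub>C S x = (\<Sum>k\<in>\<Lambda> - {l}. P k x)"
        unfolding S_def bounded_clinear_sum[OF bounded_N] cvec.scale_sum_right sum_subtractf[symmetric]
        by (intro sum.cong refl) (simp add: bounded_clinear_scaleC[OF bounded_N] N_P
            scaleC_scaleC mult.commute[of l] flip: cvec.scale_left_diff_distrib right_diff_distrib)
      then show ?thesis
        by (simp add: sum_P_minus)
    qed
    ultimately have "bounded_clinear S \<and> compact_op (\<lambda>x. S (N x - l *\<^sub>C x) - x)
        \<and> compact_op (\<lambda>x. (N (S x) - l *\<^sub>C S x) - x)"
      using compact by simp
    then show ?thesis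
      unfolding essential_spectrum_def by blast
  qed
  ultimately show ?thesis
    by blast
qed

lemma essential_spectrum_subset:
  assumes "total_orthonormal (e :: nat \<Rightarrow> 'a)"
  shows "essential_spectrum N \<subseteq> \<Lambda>"
  by (rule subsetI, rule ccontr) (simp add: essential_spectrum_iff[OF assms] P_outside)

end

section \<open>Perturbations of orthonormal sequences\<close>

text \<open>Gaussian elimination: equation \<open>i\<close> is solved for the unknown of a pivot
  \<open>j0\<close>, which lowers both counts by one.\<close>

lemma homogeneous_system:
  fixes a :: "'i \<Rightarrow> 'j \<Rightarrow> complex"
  assumes "finite I" "finite J" "card I < card J"
  shows "\<exists>c. (\<exists>j\<in>J. c j \<noteq> 0) \<and> (\<forall>i\<in>I. (\<Sum>j\<in>J. c j * a i j) = 0)"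
  using assms
proof (induction I arbitrary: J a)
  case empty
  then show ?case
    by (intro exI[of _ "\<lambda>_. 1"]) (auto simp: card_gt_0_iff)
next
  case (insert i I)
  show ?case
  proof (cases "\<forall>j\<in>J. a i j = 0")
    case True
    have "\<exists>c. (\<exists>j\<in>J. c j \<noteq> 0) \<and> (\<forall>i\<in>I. (\<Sum>j\<in>J. c j * a i j) = 0)"
      using insert.hyps insert.prems by (intro insert.IH) auto
    with True show ?thesis
      by auto
  next
    case False
    then obtain j0 where j0: "j0 \<in> J" "a i j0 \<noteq> 0"
      by blast
    let ?J = "J - {j0}"
    have "card I < card ?J"
      using insert.hyps insert.prems j0 by simp
    then obtain c where c: "\<exists>j\<in>?J. c j \<noteq> 0"
        "\<And>k. k \<in> I \<Longrightarrow> (\<Sum>j\<in>?J. c j * (a k j - a k j0 * a i j / a i j0)) = 0"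
      using insert.IH[of ?J "\<lambda>k j. a k j - a k j0 * a i j / a i j0"] insert.prems by auto
    define s where "s = (\<Sum>j\<in>?J. c j * a i j)"
    \<comment> \<open>Back substitution: the value at \<open>j0\<close> is forced by equation
      \<open>i\<close>.\<close>
    define c' where "c' = (\<lambda>j. if j = j0 then - s / a i j0 else c j)"
    have split: "(\<Sum>j\<in>J. c' j * b j) = - s / a i j0 * b j0 + (\<Sum>j\<in>?J. c j * b j)" for b
    proof -
      have "(\<Sum>j\<in>?J. c' j * b j) = (\<Sum>j\<in>?J. c j * b j)"
        by (intro sum.cong refl) (simp add: c'_def)
      then show ?thesis
        using sum.remove[OF insert.prems(1) j0(1), of "\<lambda>j. c' j * b j"] by (simp add: c'_def)
    qed
    have "(\<Sum>j\<in>J. c' j * a k j) = 0" if "k \<in> I" for k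
    proof -
      have "(\<Sum>j\<in>?J. c j * a k j) - a k j0 / a i j0 * s
          = (\<Sum>j\<in>?J. c j * (a k j - a k j0 * a i j / a i j0))"
        by (simp add: s_def sum_distrib_left sum_subtractf[symmetric] algebra_simps)
      with c(2)[OF that] show ?thesis
        by (simp add: split)
    qed
    moreover have "(\<Sum>j\<in>J. c' j * a i j) = 0"
      using j0(2) by (simp add: split s_def)
    moreover have "\<exists>j\<in>J. c' j \<noteq> 0"
      using c(1) by (auto simp: c'_def)
    ultimately show ?thesis
      by (intro exI[of _ c']) simp
  qed
qed

text \<open>
  Otherwise a dimension count gives a nonzero vector in the span of the first \<open>k\<close> vectors of \<open>f\<close>
  that is orthogonal to the first \<open>m\<close> vectors of \<open>e\<close>, contradicting Parseval's identity.
\<close>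

lemma orthonormal_shift_le:
  fixes e f :: "nat \<Rightarrow> 'a::chilbert_space"
  assumes e: "total_orthonormal e" and f: "orthonormal_on UNIV f"
    and summ: "summable (\<lambda>j. (norm (f (k + j) - e (m + j)))\<^sup>2)"
    and small: "(\<Sum>j. (norm (f (k + j) - e (m + j)))\<^sup>2) < 1"
  shows "k \<le> m"
proof (rule ccontr)
  assume "\<not> k \<le> m"
  then have "card {..<m} < card {..<k}"
    by simp
  then obtain c where c: "\<exists>j\<in>{..<k}. c j \<noteq> 0" "\<And>i. i < m \<Longrightarrow> (\<Sum>j<k. c j * cinner (f j) (e i)) = 0"
    using homogeneous_system[of "{..<m}" "{..<k}" "\<lambda>i j. cinner (f j) (e i)"] by auto
  define v where "v = (\<Sum>j<k. c j *\<^sub>C f j)"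
  define q where "q = (\<lambda>j. (norm (f (k + j) - e (m + j)))\<^sup>2)"
  obtain j where "j < k" "c j \<noteq> 0"
    using c(1) by blast
  then have "(\<Sum>j<k. (norm (c j))\<^sup>2) > 0"
    by (intro sum_pos2[of _ j]) auto
  also have "(\<Sum>j<k. (norm (c j))\<^sup>2) = (norm v)\<^sup>2"
    unfolding v_def by (intro norm_lincomb[symmetric] orthonormal_on_subset[OF f]) auto
  finally have v: "(norm v)\<^sup>2 > 0" .
  have ve: "cinner v (e i) = 0" if "i < m" for i
    using c(2)[OF that] by (simp add: v_def cinner_sum_left cinner_scaleC_left)
  have vf: "cinner v (f (k + j)) = 0" for j
    unfolding v_def cinner_sum_left
    by (intro sum.neutral) (auto simp: cinner_scaleC_left orthonormal_onD[OF f])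
  have "(\<lambda>j. (norm (cinner v (e (j + m))))\<^sup>2) sums ((norm v)\<^sup>2 - (\<Sum>i<m. (norm (cinner v (e i)))\<^sup>2))"
    by (intro sums_split_initial_segment parseval e)
  then have *: "(\<lambda>j. (norm (cinner v (e (m + j))))\<^sup>2) sums (norm v)\<^sup>2"
    by (simp add: ve add.commute)
  have term_le: "(norm (cinner v (e (m + j))))\<^sup>2 \<le> (norm v)\<^sup>2 * q j" for j
  proof -
    have "norm (cinner v (e (m + j))) = norm (cinner v (f (k + j) - e (m + j)))"
      by (simp add: cinner_diff_right vf)
    also have "\<dots> \<le> norm v * norm (f (k + j) - e (m + j))"
      by (rule norm_cinner_le)
    finally show ?thesis
      unfolding q_def power_mult_distrib[symmetric] by (intro power_mono) auto
  qed
  have **: "(\<lambda>j. (norm v)\<^sup>2 * q j) sums ((norm v)\<^sup>2 * (\<Sum>j. q j))"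
    using summ unfolding q_def by (intro sums_mult summable_sums)
  have "(norm v)\<^sup>2 \<le> (norm v)\<^sup>2 * (\<Sum>j. q j)"
    by (rule sums_le[OF term_le * **])
  also have "\<dots> < (norm v)\<^sup>2 * 1"
    using v small unfolding q_def by (intro mult_strict_left_mono)
  finally show False
    by simp
qed

text \<open>Normalizing by \<open>sgn\<close> gives the value 0 on a linearly dependent vector, so
  the recursion is total without assuming independence.\<close>

function gram_schmidt :: "(nat \<Rightarrow> 'a::complex_inner) \<Rightarrow> nat \<Rightarrow> 'a" where
  "gram_schmidt g n = sgn (g n - (\<Sum>k<n. cinner (g n) (gram_schmidt g k) *\<^sub>C gram_schmidt g k))"
  by auto
termination
  by (relation "measures [snd]") auto

declare gram_schmidt.simps [simp del]

lemma span_image_lincomb: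
  fixes g :: "'i \<Rightarrow> 'a::complex_inner"
  assumes "finite A" "x \<in> cvec.span (g ` A)"
  obtains a where "x = (\<Sum>k\<in>A. a k *\<^sub>C g k)"
proof -
  let ?L = "range (\<lambda>a. \<Sum>k\<in>A. a k *\<^sub>C g k)"
  have "cvec.subspace ?L"
  proof (rule cvec.subspaceI)
    show "0 \<in> ?L"
      by (rule range_eqI[of _ _ "\<lambda>_. 0"]) simp
    show "x + y \<in> ?L" if xy: "x \<in> ?L" "y \<in> ?L" for x y
    proof -
      obtain a b where "x = (\<Sum>k\<in>A. a k *\<^sub>C g k)" "y = (\<Sum>k\<in>A. b k *\<^sub>C g k)"
        using xy by blast
      then have "x + y = (\<Sum>k\<in>A. (a k + b k) *\<^sub>C g k)"
        by (simp add: scaleC_add_left sum.distrib)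
      then show ?thesis
        by (intro range_eqI[where x = "\<lambda>k. a k + b k"])
    qed
    show "c *\<^sub>C x \<in> ?L" if x: "x \<in> ?L" for c x
    proof -
      obtain a where "x = (\<Sum>k\<in>A. a k *\<^sub>C g k)"
        using x by blast
      then have "c *\<^sub>C x = (\<Sum>k\<in>A. (c * a k) *\<^sub>C g k)"
        by (simp add: cvec.scale_sum_right scaleC_scaleC)
      then show ?thesis
        by (intro range_eqI[where x = "\<lambda>k. c * a k"])
    qed
  qed
  moreover have "g ` A \<subseteq> ?L"
  proof
    fix y
    assume "y \<in> g ` A"
    then obtain j where j: "j \<in> A" "y = g j"
      by blast
    have "(\<Sum>k\<in>A. (if k = j then 1 else 0) *\<^sub>C g k) = (\<Sum>k\<in>A. if k = j then g k else 0)"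
      by (intro sum.cong refl) simp
    then have "y = (\<Sum>k\<in>A. (if k = j then 1 else 0) *\<^sub>C g k)"
      using assms(1) j by simp
    then show "y \<in> ?L"
      by (intro range_eqI[where x = "\<lambda>k. if k = j then 1 else 0"])
  qed
  ultimately have "cvec.span (g ` A) \<subseteq> ?L"
    by (intro cvec.span_minimal)
  with assms(2) have "x \<in> ?L"
    by blast
  then show thesis
    using that by blast
qed

text \<open>Normalizing moves \<open>h\<close> by the difference of its length from 1, the length of
  \<open>e\<close>, hence by at most \<open>norm (h - e)\<close>.\<close>

lemma norm_sgn_diff_le:
  fixes h :: "'a::real_normed_vector"
  assumes "h \<noteq> 0" "norm e = 1"
  shows "norm (sgn h - e) \<le> 2 * norm (h - e)"
proof -
  have "sgn h - h = (inverse (norm h) - 1) *\<^sub>R h"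
    by (simp add: sgn_div_norm scaleR_left_diff_distrib)
  then have "norm (sgn h - h) = \<bar>inverse (norm h) - 1\<bar> * norm h"
    by simp
  also have "\<dots> = \<bar>(inverse (norm h) - 1) * norm h\<bar>"
    by (simp add: abs_mult)
  also have "\<dots> = \<bar>norm e - norm h\<bar>"
    using assms by (simp add: left_diff_distrib)
  also have "\<dots> \<le> norm (h - e)"
    by (metis norm_minus_commute norm_triangle_ineq3)
  finally show ?thesis
    using norm_triangle_ineq[of "sgn h - h" "h - e"] by simp
qed

text \<open>
  If \<open>u = (\<Sum>k<n. a k *\<^sub>C g k)\<close> is the projection of \<open>g n\<close> to the span of the previous vectors, then
  \<open>(norm u)\<^sup>2 = cinner (g n) u\<close> is at most \<open>norm a * norm (e n - g n)\<close>, while \<open>norm a \<le> 2 * norm u\<close>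
  because \<open>g\<close> is a small perturbation of \<open>e\<close>. So orthonormalization moves \<open>g n\<close> only
  by a multiple of \<open>norm (e n - g n)\<close>.
\<close>

lemma gram_schmidt_perturbation:
  fixes e g :: "nat \<Rightarrow> 'a::complex_inner"
  assumes e: "orthonormal_on UNIV e"
    and W: "\<And>n. cvec.subspace (W n)" "\<And>n. g n \<in> W n"
      "\<And>k n. W k = W n \<or> (\<forall>x\<in>W n. \<forall>y\<in>W k. cinner x y = 0)"
    and cross: "\<And>k n. k \<noteq> n \<Longrightarrow> norm (cinner (g n) (g k)) \<le> norm (cinner (e n - g n) (e k))"
    and small: "\<And>n. (\<Sum>k<n. (norm (e k - g k))\<^sup>2) \<le> 1 / 64"
  defines "f \<equiv> gram_schmidt g"
  shows "orthonormal_on UNIV f" "f n \<in> W n" "norm (f n - e n) \<le> 6 * norm (e n - g n)"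
proof -
  \<comment> \<open>Stated relative to an orthonormal prefix, because the induction below uses it
    before all of \<open>f\<close> is known to be orthonormal.\<close>
  have bound: "norm (\<Sum>k<n. cinner (g n) (f k) *\<^sub>C f k) \<le> 2 * norm (e n - g n)"
    if on: "orthonormal_on {..<n} f" and span: "\<And>k. k < n \<Longrightarrow> f k \<in> cvec.span (g ` {..k})" for n
  proof -
    define u where "u = (\<Sum>k<n. cinner (g n) (f k) *\<^sub>C f k)"
    have "u \<in> cvec.span (g ` {..<n})"
      unfolding u_def
    proof (intro cvec.span_sum cvec.span_scale)
      fix k
      assume "k \<in> {..<n}"
      then have "cvec.span (g ` {..k}) \<subseteq> cvec.span (g ` {..<n})"
        by (intro cvec.span_mono image_mono) auto
      then show "f k \<in> cvec.span (g ` {..<n})"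
        using span \<open>k \<in> {..<n}\<close> by blast
    qed
    then obtain a where a: "u = (\<Sum>k<n. a k *\<^sub>C g k)"
      by (rule span_image_lincomb[OF finite_lessThan])
    define \<alpha> where "\<alpha> = L2_set (\<lambda>k. norm (a k)) {..<n}"
    have "(norm (\<Sum>k<n. a k *\<^sub>C e k))\<^sup>2 = \<alpha>\<^sup>2"
      unfolding \<alpha>_def L2_set_def
      by (subst norm_lincomb) (auto intro: orthonormal_on_subset[OF e] simp: real_sqrt_pow2[OF sum_nonneg])
    then have v: "norm (\<Sum>k<n. a k *\<^sub>C e k) = \<alpha>"
      by (simp add: \<alpha>_def)
    have "norm (\<Sum>k<n. a k *\<^sub>C (e k - g k)) \<le> (\<Sum>k<n. \<bar>norm (a k)\<bar> * \<bar>norm (e k - g k)\<bar>)"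
      by (rule order_trans[OF norm_sum]) (simp add: norm_scaleC)
    also have "\<dots> \<le> \<alpha> * L2_set (\<lambda>k. norm (e k - g k)) {..<n}"
      unfolding \<alpha>_def by (rule L2_set_mult_ineq)
    also have "\<dots> \<le> \<alpha> * (1 / 8)"
    proof (rule mult_left_mono)
      have "L2_set (\<lambda>k. norm (e k - g k)) {..<n} \<le> sqrt ((1 / 8)\<^sup>2)"
        unfolding L2_set_def using small[of n] by (intro real_sqrt_le_mono) (simp add: power2_eq_square)
      then show "L2_set (\<lambda>k. norm (e k - g k)) {..<n} \<le> 1 / 8"
        by simp
    qed (simp add: \<alpha>_def)
    \<comment> \<open>Weakened from 1/8 to 1/2, so that the term is absorbed and
      \<open>\<alpha> \<le> 2 * norm u\<close> results.\<close>
    finally have "norm (\<Sum>k<n. a k *\<^sub>C (e k - g k)) \<le> \<alpha> / 2"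
      using L2_set_nonneg[of "\<lambda>k. norm (a k)" "{..<n}"] unfolding \<alpha>_def by linarith
    moreover have "(\<Sum>k<n. a k *\<^sub>C e k) = u + (\<Sum>k<n. a k *\<^sub>C (e k - g k))"
      by (simp add: a cvec.scale_right_diff_distrib sum_subtractf)
    then have "\<alpha> \<le> norm u + norm (\<Sum>k<n. a k *\<^sub>C (e k - g k))"
      using v norm_triangle_ineq by metis
    ultimately have \<alpha>: "\<alpha> \<le> 2 * norm u"
      by simp
    have "cinner (g n - u) u = 0"
    proof -
      have "cinner (g n - u) (f k) = 0" if "k < n" for k
        unfolding u_def using that by (intro cinner_diff_proj on) auto
      moreover have "cinner (g n - u) u = (\<Sum>k<n. cnj (cinner (g n) (f k)) * cinner (g n - u) (f k))"
        unfolding u_def[THEN arg_cong[where f = "cinner (g n - u)"]]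
        by (simp only: cinner_sum_right cinner_scaleC_right)
      ultimately show ?thesis
        by simp
    qed
    then have "(norm u)\<^sup>2 = norm (cinner (g n) u)"
      by (simp add: cinner_diff_left norm_cinner_self)
    also have "cinner (g n) u = (\<Sum>k<n. cnj (a k) * cinner (g n) (g k))"
      by (simp add: a cinner_sum_right cinner_scaleC_right)
    \<comment> \<open>\<open>cross\<close> trades the Gram matrix entries for the coefficients of
      the single vector \<open>e n - g n\<close>, whose square sum Bessel's inequality
      controls.\<close>
    also have "norm \<dots> \<le> (\<Sum>k<n. \<bar>norm (a k)\<bar> * \<bar>norm (cinner (e n - g n) (e k))\<bar>)"
      by (rule order_trans[OF norm_sum], rule sum_mono)
         (auto simp: norm_mult intro!: mult_left_mono cross)
    also have "\<dots> \<le> \<alpha> * L2_set (\<lambda>k. norm (cinner (e n - g n) (e k))) {..<n}"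
      unfolding \<alpha>_def by (rule L2_set_mult_ineq)
    also have "\<dots> \<le> \<alpha> * norm (e n - g n)"
    proof (rule mult_left_mono)
      have "L2_set (\<lambda>k. norm (cinner (e n - g n) (e k))) {..<n} \<le> sqrt ((norm (e n - g n))\<^sup>2)"
        unfolding L2_set_def
        by (intro real_sqrt_le_mono bessel orthonormal_on_subset[OF e]) auto
      then show "L2_set (\<lambda>k. norm (cinner (e n - g n) (e k))) {..<n} \<le> norm (e n - g n)"
        by simp
    qed (simp add: \<alpha>_def)
    also have "\<dots> \<le> 2 * norm u * norm (e n - g n)"
      using \<alpha> by (intro mult_right_mono) auto
    finally have "norm u * norm u \<le> norm u * (2 * norm (e n - g n))"
      by (simp add: power2_eq_square mult_ac)
    then have "norm u \<le> 2 * norm (e n - g n)"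
      by (cases "norm u = 0") auto
    then show ?thesis
      by (simp add: u_def)
  qed
  have inv: "orthonormal_on {..<n} f \<and> (\<forall>k<n. f k \<in> cvec.span (g ` {..k}) \<and> f k \<in> W k
      \<and> norm (f k - e k) \<le> 6 * norm (e k - g k))" for n
  proof (induction n)
    case 0
    show ?case
      by (simp add: orthonormal_on_def)
  next
    case (Suc n)
    then have on: "orthonormal_on {..<n} f" and span: "\<And>k. k < n \<Longrightarrow> f k \<in> cvec.span (g ` {..k})"
      and fW: "\<And>k. k < n \<Longrightarrow> f k \<in> W k"
      by auto
    define u where "u = (\<Sum>k<n. cinner (g n) (f k) *\<^sub>C f k)"
    define h where "h = g n - u"
    have fn: "f n = sgn h"
      unfolding f_def h_def u_def by (rule gram_schmidt.simps)
    then have fn': "f n = complex_of_real (inverse (norm h)) *\<^sub>C h"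
      by (simp only: sgn_div_norm scaleC_of_real)
    have "norm u \<le> 2 * norm (e n - g n)"
      unfolding u_def by (rule bound[OF on span])
    then have he: "norm (h - e n) \<le> 3 * norm (e n - g n)"
      using norm_triangle_ineq4[of "g n - e n" u] by (simp add: h_def norm_minus_commute algebra_simps)
    have "(norm (e n - g n))\<^sup>2 \<le> (\<Sum>k<Suc n. (norm (e k - g k))\<^sup>2)"
      by (simp add: sum_nonneg)
    also have "\<dots> \<le> (1 / 8)\<^sup>2"
      using small[of "Suc n"] by (simp add: power2_eq_square)
    finally have "norm (e n - g n) \<le> 1 / 8"
      by (rule power2_le_imp_le) simp
    have ne: "norm (e n) = 1"
      by (rule orthonormal_on_norm[OF e]) simp
    \<comment> \<open>The distance from \<open>h\<close> to the unit vector \<open>e n\<close> is at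
      most 3/8.\<close>
    have "h \<noteq> 0"
      using he ne \<open>norm (e n - g n) \<le> 1 / 8\<close> by auto
    have "norm (f n - e n) \<le> 6 * norm (e n - g n)"
      using norm_sgn_diff_le[OF \<open>h \<noteq> 0\<close> ne] he by (simp add: fn)
    moreover have "f n \<in> cvec.span (g ` {..n})"
      unfolding fn' h_def u_def
    proof (intro cvec.span_scale cvec.span_diff cvec.span_sum)
      show "g n \<in> cvec.span (g ` {..n})"
        by (intro cvec.span_base) auto
      fix k
      assume "k \<in> {..<n}"
      then have "cvec.span (g ` {..k}) \<subseteq> cvec.span (g ` {..n})"
        by (intro cvec.span_mono image_mono) auto
      then show "f k \<in> cvec.span (g ` {..n})"
        using span \<open>k \<in> {..<n}\<close> by blast
    qed
    moreover have "u \<in> W n"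
      unfolding u_def
    proof (rule cvec.subspace_sum[OF W(1)])
      fix k
      assume "k \<in> {..<n}"
      then have "f k \<in> W k"
        using fW by simp
      \<comment> \<open>Either \<open>k\<close> belongs to the same eigenspace, or its term in the
        projection vanishes; thus orthonormalization never leaves \<open>W n\<close>.\<close>
      then consider "f k \<in> W n" | "cinner (g n) (f k) = 0"
        using W(2)[of n] W(3)[of k n] by blast
      then show "cinner (g n) (f k) *\<^sub>C f k \<in> W n"
        by cases (use W(1)[of n] in \<open>simp_all add: cvec.subspace_scale cvec.subspace_0\<close>)
    qed
    then have "f n \<in> W n"
      unfolding fn' h_def by (intro cvec.subspace_scale cvec.subspace_diff W(1,2))
    moreover have "orthonormal_on {..<Suc n} f"
    proof -
      have "cinner (f n) (f k) = 0" if "k < n" for k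
      proof -
        have "cinner h (f k) = 0"
          unfolding h_def u_def using that by (intro cinner_diff_proj on) auto
        then show ?thesis
          by (simp add: fn' cinner_scaleC_left)
      qed
      moreover have "cinner (f n) (f n) = 1"
        using \<open>h \<noteq> 0\<close> by (simp add: fn cinner_self norm_sgn)
      ultimately show ?thesis
        using on cinner_eq_zero_commute[of "f n"]
        unfolding orthonormal_on_def by (auto simp: less_Suc_eq)
    qed
    ultimately show ?case
      using Suc by (auto simp: less_Suc_eq)
  qed
  show "orthonormal_on UNIV f"
    unfolding orthonormal_on_def
  proof (intro ballI)
    fix i j
    show "cinner (f i) (f j) = (if i = j then 1 else 0)"
      using inv[of "Suc (max i j)"] by (intro orthonormal_onD) auto
  qed
  show "f n \<in> W n" "norm (f n - e n) \<le> 6 * norm (e n - g n)"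
    using inv[of "Suc n"] by auto
qed

section \<open>Diagonalization by Hilbert--Schmidt perturbations of the identity\<close>

lemma diagonalizable_by_eigenbasis:
  fixes e f :: "nat \<Rightarrow> 'a::chilbert_space"
  assumes N: "bounded_clinear N" and e: "total_orthonormal e" and f: "total_orthonormal f"
    and eig: "\<And>n. \<exists>l. N (f n) = l *\<^sub>C f n"
    and summ: "summable (\<lambda>n. (norm (f n - e n))\<^sup>2)"
  shows "diagonalizable_by_HS_perturbation e N"
  unfolding diagonalizable_by_HS_perturbation_def
proof (intro exI conjI)
  let ?U = "basis_map f e" and ?K = "\<lambda>x. basis_map f e x - x"
  note U = bounded_clinear_basis_map[OF f e]
  show "unitary_op ?U"
    by (rule unitary_basis_map[OF f e])
  show "?U = (\<lambda>x. x + ?K x)"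
    by simp
  have "norm (?K (e n)) = norm (f n - e n)" for n
  proof -
    \<comment> \<open>The unitary sends \<open>f n\<close> to \<open>e n\<close>; being isometric,
      it turns the Hilbert-Schmidt sum into the given series.\<close>
    have "?K (e n) = ?U (e n - f n)"
      by (simp add: bounded_clinear_diff[OF U] basis_map_basis[OF f e])
    then show ?thesis
      by (simp add: norm_basis_map[OF f e] norm_minus_commute)
  qed
  then show "hilbert_schmidt e ?K"
    using summ bounded_clinear_minus_op[OF U bounded_clinear_ident]
    by (simp add: hilbert_schmidt_def)
  show "diagonal_op e (?U \<circ> N \<circ> cadjoint ?U)"
    unfolding diagonal_op_def cadjoint_basis_map[OF f e]
  proof (intro conjI allI impI)
    show "bounded_clinear (?U \<circ> N \<circ> basis_map e f)"
      using bounded_clinear_compose[OF U bounded_clinear_compose[OF N bounded_clinear_basis_map[OF e f]]]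
      by (simp add: comp_def)
    fix i j :: nat
    assume "i \<noteq> j"
    obtain l where "N (f j) = l *\<^sub>C f j"
      using eig by blast
    then have "(?U \<circ> N \<circ> basis_map e f) (e j) = l *\<^sub>C e j"
      by (simp add: basis_map_basis[OF e f] basis_map_basis[OF f e] bounded_clinear_scaleC[OF U])
    then show "cinner ((?U \<circ> N \<circ> basis_map e f) (e j)) (e i) = 0"
      using \<open>i \<noteq> j\<close> orthonormal_onD[OF total_orthonormalD(1)[OF e]] by (simp add: cinner_scaleC_left)
  qed
qed

text \<open>
  Writing \<open>e n = f n + k n\<close> with \<open>f n\<close> a unit eigenvector for \<open>l\<close>, all terms of
  \<open>cinner (N (e n)) (e n) - l\<close> except the one quadratic in \<open>k n\<close> vanish by normality.
\<close>

lemma diagonalizable_imp_Lim1: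
  fixes e :: "nat \<Rightarrow> 'a::chilbert_space" and N :: "'a \<Rightarrow> 'a"
  assumes e: "total_orthonormal e" and N: "bounded_clinear N"
    and A: "is_adjoint N A" "\<And>x. N (A x) = A (N x)"
    and fin: "finite (op_spectrum N)"
    and diag: "diagonalizable_by_HS_perturbation e N"
  shows "(\<lambda>n. cinner (N (e n)) (e n)) \<in> Lim1 (essential_spectrum N)"
proof -
  note on = total_orthonormalD(1)[OF e]
  have norm_e: "norm (e n) = 1" for n
    by (rule orthonormal_on_norm[OF on]) simp
  obtain B where B: "B > 0" "\<And>x. norm (N x) \<le> B * norm x"
    using bounded_clinear_pos_bound[OF N] by blast
  obtain U K where U: "unitary_op U" and K: "hilbert_schmidt e K" and UK: "U = (\<lambda>x. x + K x)"
    and D: "diagonal_op e (U \<circ> N \<circ> cadjoint U)"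
    using diag by (auto simp: diagonalizable_by_HS_perturbation_def)
  define V where "V = cadjoint U"
  have U': "bounded_clinear U" and VU: "\<And>x. V (U x) = x" and UV: "\<And>x. U (V x) = x"
    using U by (auto simp: unitary_op_def V_def fun_eq_iff)
  have adj: "is_adjoint U V"
    unfolding V_def by (rule is_adjoint_cadjoint[OF e U'])
  then have adj': "cinner (U x) y = cinner x (V y)" for x y
    by (simp add: is_adjoint_def)
  have V': "bounded_clinear V"
    by (rule bounded_clinear_adjoint[OF adj U'])
  have norm_U: "norm (U x) = norm x" for x
  proof -
    have "cinner (U x) (U x) = cinner x x"
      by (simp add: adj' VU)
    then have "(norm (U x))\<^sup>2 = (norm x)\<^sup>2"
      by (simp only: cinner_self of_real_eq_iff)
    then show ?thesis
      by (simp only: power2_eq_iff_nonneg norm_ge_zero)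
  qed
  define f where "f = (\<lambda>n. V (e n))"
  define \<delta> where "\<delta> = (\<lambda>n. cinner (U (N (f n))) (e n))"
  have f_on: "orthonormal_on UNIV f"
    unfolding orthonormal_on_def f_def
    by (simp add: adj'[symmetric] UV orthonormal_onD[OF on])
  have norm_f: "norm (f n) = 1" for n
    by (rule orthonormal_on_norm[OF f_on]) simp
  have eig: "N (f n) = \<delta> n *\<^sub>C f n" for n
  proof -
    have "U (N (f n)) = \<delta> n *\<^sub>C e n"
    proof (rule total_orthonormal_ext[OF e])
      fix i
      show "cinner (U (N (f n))) (e i) = cinner (\<delta> n *\<^sub>C e n) (e i)"
        using D by (cases "i = n") (simp_all add: \<delta>_def f_def V_def diagonal_op_def
            cinner_scaleC_left orthonormal_onD[OF on])
    qed
    then have "V (U (N (f n))) = \<delta> n *\<^sub>C f n"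
      by (simp add: f_def bounded_clinear_scaleC[OF V'])
    then show ?thesis
      by (simp add: VU)
  qed
  have \<delta>_spec: "\<delta> n \<in> op_spectrum N" for n
  proof (rule ccontr)
    assume "\<delta> n \<notin> op_spectrum N"
    then obtain S where S: "bounded_clinear S" "S \<circ> (\<lambda>x. N x - \<delta> n *\<^sub>C x) = id"
      unfolding not_in_op_spectrum cinvertible_def by blast
    have "S (N (f n) - \<delta> n *\<^sub>C f n) = f n"
      using fun_cong[OF S(2), of "f n"] by simp
    then have "f n = 0"
      by (simp add: eig bounded_clinear_zero[OF S(1)])
    with norm_f[of n] show False
      by simp
  qed
  \<comment> \<open>The \<open>f n\<close> with value \<open>l\<close> are orthonormal eigenvectors,
    and an inessential \<open>l\<close> admits only boundedly many. As the spectrum is finite, all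
    but finitely many \<open>\<delta> n\<close> are essential.\<close>
  have finite_level: "finite {n. \<delta> n = l}" if l: "l \<notin> essential_spectrum N" for l
  proof (rule ccontr)
    assume inf: "infinite {n. \<delta> n = l}"
    obtain k where k: "\<And>B. finite B \<Longrightarrow> B \<subseteq> {x. N x = l *\<^sub>C x} \<Longrightarrow> orthonormal_on B (\<lambda>x. x) \<Longrightarrow> card B \<le> k"
      using not_essential_card_bound[OF l] by blast
    obtain T where T: "T \<subseteq> {n. \<delta> n = l}" "finite T" "card T = Suc k"
      using infinite_arbitrarily_large[OF inf] by metis
    have inj: "inj f"
    proof (rule injI, rule ccontr)
      fix i j
      assume "f i = f j" "i \<noteq> j"
      then show False
        using orthonormal_onD[OF f_on, of i j] orthonormal_onD[OF f_on, of i i] by simp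
    qed
    have "orthonormal_on (f ` T) (\<lambda>x. x)"
      unfolding orthonormal_on_def using inj
      by (auto simp: orthonormal_onD[OF f_on] inj_eq)
    moreover have "f ` T \<subseteq> {x. N x = l *\<^sub>C x}"
      using T(1) eig by auto
    ultimately have "card (f ` T) \<le> k"
      using T(2) by (intro k) auto
    moreover have "card (f ` T) = card T"
      by (intro card_image inj_on_subset[OF inj]) auto
    ultimately show False
      using T(3) by simp
  qed
  have "{n. \<delta> n \<notin> essential_spectrum N} \<subseteq> (\<Union>l\<in>op_spectrum N - essential_spectrum N. {n. \<delta> n = l})"
    using \<delta>_spec by auto
  moreover have "finite (\<Union>l\<in>op_spectrum N - essential_spectrum N. {n. \<delta> n = l})"
    using fin finite_level by auto
  ultimately have "finite {n. \<delta> n \<notin> essential_spectrum N}"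
    by (rule finite_subset)
  then have ev: "\<forall>\<^sub>F n in sequentially. \<delta> n \<in> essential_spectrum N"
    by (simp add: eventually_cofinite flip: cofinite_eq_sequentially)
  have dist_bound: "dist (cinner (N (e n)) (e n)) (\<delta> n) \<le> 2 * B * (norm (K (e n)))\<^sup>2" for n
  proof -
    define k where "k = e n - f n"
    \<comment> \<open>\<open>U\<close> sends \<open>f n\<close> back to \<open>e n\<close>, so
      \<open>U k\<close> is \<open>U (e n) - e n\<close>.\<close>
    have "U k = K (e n)"
      by (simp add: k_def bounded_clinear_diff[OF U'] f_def UV) (simp add: UK)
    then have norm_k: "norm k = norm (K (e n))"
      using norm_U[of k] by simp
    have "cinner (N k - \<delta> n *\<^sub>C k) (f n) = 0"
    proof -
      have "cinner (N k) (f n) = cinner k (A (f n))"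
        using A(1) by (simp add: is_adjoint_def)
      also have "\<dots> = \<delta> n * cinner k (f n)"
        using normal_eigenvector_adjoint[OF N A eig] by (simp add: cinner_scaleC_right)
      finally show ?thesis
        by (simp add: cinner_diff_left cinner_scaleC_left)
    qed
    moreover have "N (e n) - \<delta> n *\<^sub>C e n = N k - \<delta> n *\<^sub>C k"
      by (simp add: k_def bounded_clinear_diff[OF N] cvec.scale_right_diff_distrib eig)
    moreover have "cinner (N (e n) - \<delta> n *\<^sub>C e n) (e n) = cinner (N (e n)) (e n) - \<delta> n"
      by (simp add: cinner_diff_left cinner_scaleC_left orthonormal_onD[OF on])
    ultimately have "cinner (N (e n)) (e n) - \<delta> n = cinner (N k - \<delta> n *\<^sub>C k) k"
      by (simp add: k_def cinner_diff_right)
    then have "dist (cinner (N (e n)) (e n)) (\<delta> n) \<le> norm (N k - \<delta> n *\<^sub>C k) * norm k"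
      unfolding dist_norm by (simp only: norm_cinner_le)
    also have "\<dots> \<le> (2 * B * norm k) * norm k"
    proof (rule mult_right_mono)
      have "norm (\<delta> n) = norm (N (f n))"
        by (simp add: eig norm_scaleC norm_f)
      also have "\<dots> \<le> B"
        using B(2)[of "f n"] by (simp add: norm_f)
      finally have "norm (\<delta> n *\<^sub>C k) \<le> B * norm k"
        by (simp add: norm_scaleC mult_right_mono)
      then show "norm (N k - \<delta> n *\<^sub>C k) \<le> 2 * B * norm k"
        using norm_triangle_ineq4[of "N k" "\<delta> n *\<^sub>C k"] B(2)[of k] by simp
    qed simp
    finally show ?thesis
      by (simp add: norm_k power2_eq_square)
  qed
  have "summable (\<lambda>n. infdist (cinner (N (e n)) (e n)) (essential_spectrum N))"
  proof (rule summable_comparison_test_ev)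
    show "\<forall>\<^sub>F n in sequentially. norm (infdist (cinner (N (e n)) (e n)) (essential_spectrum N))
        \<le> 2 * B * (norm (K (e n)))\<^sup>2"
      using ev
    proof (rule eventually_mono)
      fix n
      assume "\<delta> n \<in> essential_spectrum N"
      then show "norm (infdist (cinner (N (e n)) (e n)) (essential_spectrum N)) \<le> 2 * B * (norm (K (e n)))\<^sup>2"
        using infdist_le[of "\<delta> n" "essential_spectrum N" "cinner (N (e n)) (e n)"] dist_bound[of n]
        by (simp add: infdist_nonneg)
    qed
    show "summable (\<lambda>n. 2 * B * (norm (K (e n)))\<^sup>2)"
      using K by (intro summable_mult) (simp add: hilbert_schmidt_def)
  qed
  moreover have "bounded (range (\<lambda>n. cinner (N (e n)) (e n)))"
    unfolding bounded_iff
  proof (intro exI ballI)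
    fix z
    assume "z \<in> range (\<lambda>n. cinner (N (e n)) (e n))"
    then obtain n where "z = cinner (N (e n)) (e n)"
      by blast
    then show "norm z \<le> B"
      using norm_cinner_le[of "N (e n)" "e n"] B(2)[of "e n"] norm_e[of n] by simp
  qed
  ultimately show ?thesis
    by (simp add: Lim1_def)
qed

text \<open>The finite set takes the first \<open>card B\<close> indices in an arbitrary order and
  \<open>f\<close> is shifted behind it, which is the shape that the dimension count
  expects.\<close>

lemma orthonormal_prepend:
  fixes f :: "nat \<Rightarrow> 'a::complex_inner"
  assumes "finite B" "orthonormal_on B (\<lambda>x. x)" "orthonormal_on UNIV f"
    and "\<And>b j. b \<in> B \<Longrightarrow> cinner b (f j) = 0"
  obtains g where "orthonormal_on UNIV g" "g ` {..<card B} = B" "\<And>j. g (card B + j) = f j"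
proof -
  obtain h where h: "bij_betw h {0..<card B} B"
    using ex_bij_betw_nat_finite[OF assms(1)] by blast
  define g where "g = (\<lambda>i. if i < card B then h i else f (i - card B))"
  have hB: "h i \<in> B" if "i < card B" for i
    using bij_betwE[OF h] that by auto
  have hh: "cinner (h i) (h j) = (if i = j then 1 else 0)" if "i < card B" "j < card B" for i j
    using orthonormal_onD[OF assms(2) hB[OF that(1)] hB[OF that(2)]]
      bij_betw_imp_inj_on[OF h] that by (auto simp: inj_on_eq_iff)
  have hf: "cinner (h i) (f j) = 0" "cinner (f j) (h i) = 0" if "i < card B" for i j
    using assms(4)[OF hB[OF that], of j] cinner_eq_zero_commute[of "h i" "f j"] by auto
  have "orthonormal_on UNIV g"
    unfolding orthonormal_on_def g_def
    by (auto simp: hh hf orthonormal_onD[OF assms(3)])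
  moreover have "g ` {..<card B} = B"
    using bij_betw_imp_surj_on[OF h] by (auto simp: g_def lessThan_atLeast0)
  moreover have "g (card B + j) = f j" for j
    by (simp add: g_def)
  ultimately show thesis
    using that by blast
qed

section \<open>From summable distance to the vertices to diagonalization\<close>

context spectral_resolution
begin

text \<open>The weights sum to 1, so \<open>z\<close> can be distributed over the convex
  combination. Real weights keep the form compatible with real linear functionals.\<close>

lemma cinner_N_minus:
  assumes "norm x = 1"
  shows "cinner (N x) x - z = (\<Sum>k\<in>\<Lambda>. (norm (P k x))\<^sup>2 *\<^sub>R (k - z))"
proof -
  have "z = z * complex_of_real (\<Sum>k\<in>\<Lambda>. (norm (P k x))\<^sup>2)"
    by (simp only: norm_square_sum_P assms) simp
  then have "cinner (N x) x - z
      = (\<Sum>k\<in>\<Lambda>. k * complex_of_real ((norm (P k x))\<^sup>2)) - z * complex_of_real (\<Sum>k\<in>\<Lambda>. (norm (P k x))\<^sup>2)"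
    using cinner_N[of x] by simp
  also have "\<dots> = (\<Sum>k\<in>\<Lambda>. (norm (P k x))\<^sup>2 *\<^sub>R (k - z))"
    unfolding of_real_sum sum_distrib_left sum_subtractf[symmetric] scaleR_conv_of_real
    by (intro sum.cong refl) (simp add: algebra_simps)
  finally show ?thesis .
qed

text \<open>
  A vertex \<open>z\<close> is strictly separated from the rest of the essential spectrum by a linear functional,
  so a numerical value close to \<open>z\<close> forces most of the mass of \<open>x\<close> into the eigenspace of \<open>z\<close>,
  up to the finite-rank part of \<open>N\<close>.
\<close>

lemma vertex_concentration:
  assumes sub: "essential_spectrum N \<subseteq> \<Lambda>"
    and z: "z extreme_point_of (convex hull (essential_spectrum N))"
  obtains a b where "a \<ge> 0" "b \<ge> 0"
    "\<And>x. norm x = 1 \<Longrightarrow> (norm (x - P z x))\<^sup>2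
       \<le> a * norm (cinner (N x) x - z) + b * (\<Sum>k\<in>\<Lambda> - essential_spectrum N. (norm (P k x))\<^sup>2)"
proof -
  let ?E = "essential_spectrum N"
  have zE: "z \<in> ?E"
    by (rule extreme_point_of_convex_hull[OF z])
  have finE: "finite ?E"
    by (rule finite_subset[OF sub finite_\<Lambda>])
  let ?H = "convex hull (?E - {z})"
  \<comment> \<open>Removing an extreme point keeps the hull convex, so \<open>z\<close> lies
    outside the hull of the remaining points and can be separated from it.\<close>
  have "convex (convex hull ?E - {z})"
    using z by (simp add: extreme_point_of_stillconvex)
  then have "?H \<subseteq> convex hull ?E - {z}"
    using hull_subset[of ?E convex] by (intro hull_minimal) auto
  then have "z \<notin> ?H"
    by blast
  moreover have "closed ?H"
    using finE by (intro compact_imp_closed finite_imp_compact_convex_hull) simp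
  ultimately obtain v c where v: "inner v z < c" "\<forall>y\<in>?H. c < inner v y"
    using separating_hyperplane_closed_point[of ?H z] by auto
  define \<delta> where "\<delta> = c - inner v z"
  have \<delta>: "\<delta> > 0"
    using v(1) by (simp add: \<delta>_def)
  have far: "\<delta> \<le> inner v (k - z)" if "k \<in> ?E - {z}" for k
    using v(2) hull_inc[OF that, of convex] by (fastforce simp: \<delta>_def inner_diff_right)
  \<comment> \<open>At inessential spectral values the functional may have either sign; a crude
    bound suffices, since their total weight is summable along the basis.\<close>
  define C where "C = (\<Sum>k\<in>\<Lambda>. \<bar>inner v (k - z)\<bar>)"
  have C: "- C \<le> inner v (k - z)" if "k \<in> \<Lambda>" for k
  proof -
    have "\<bar>inner v (k - z)\<bar> \<le> C"
      unfolding C_def using that finite_\<Lambda> by (intro member_le_sum) auto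
    then show ?thesis
      by linarith
  qed
  have "C \<ge> 0"
    unfolding C_def by (intro sum_nonneg) simp
  show thesis
  \<comment> \<open>The squared distance is \<open>s + t\<close>. Separation bounds \<open>s\<close>
    with the coefficient \<open>C / \<delta>\<close> on \<open>t\<close>, and the added 1 accounts
    for \<open>t\<close> itself.\<close>
  proof (rule that[of "norm v / \<delta>" "C / \<delta> + 1"])
    show "norm v / \<delta> \<ge> 0" "C / \<delta> + 1 \<ge> 0"
      using \<delta> \<open>C \<ge> 0\<close> by simp_all
    fix x :: 'a
    assume x: "norm x = 1"
    define p where "p = (\<lambda>k. (norm (P k x))\<^sup>2)"
    define s where "s = (\<Sum>k\<in>?E - {z}. p k)"
    define t where "t = (\<Sum>k\<in>\<Lambda> - ?E. p k)"
    have split: "(\<Sum>k\<in>\<Lambda> - {z}. q k) = (\<Sum>k\<in>?E - {z}. q k) + (\<Sum>k\<in>\<Lambda> - ?E. q k)" for q :: "complex \<Rightarrow> real"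
    proof -
      have "\<Lambda> - {z} = (?E - {z}) \<union> (\<Lambda> - ?E)"
        using sub zE by auto
      moreover have "(?E - {z}) \<inter> (\<Lambda> - ?E) = {}"
        by auto
      ultimately show ?thesis
        using finE finite_\<Lambda> by (simp add: sum.union_disjoint)
    qed
    have "inner v (cinner (N x) x - z) = (\<Sum>k\<in>\<Lambda>. p k * inner v (k - z))"
      unfolding cinner_N_minus[OF x] by (simp add: inner_sum_right p_def)
    also have "\<dots> = (\<Sum>k\<in>\<Lambda> - {z}. p k * inner v (k - z))"
      using sub zE finite_\<Lambda> by (intro sum.mono_neutral_right) auto
    also have "\<dots> = (\<Sum>k\<in>?E - {z}. p k * inner v (k - z)) + (\<Sum>k\<in>\<Lambda> - ?E. p k * inner v (k - z))"
      by (rule split)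
    also have "\<dots> \<ge> (\<Sum>k\<in>?E - {z}. p k * \<delta>) + (\<Sum>k\<in>\<Lambda> - ?E. p k * - C)"
      by (intro add_mono sum_mono mult_left_mono far C) (auto simp: p_def)
    finally have "s * \<delta> - t * C \<le> inner v (cinner (N x) x - z)"
      by (simp add: s_def t_def sum_distrib_right sum_negf)
    also have "\<dots> \<le> norm v * norm (cinner (N x) x - z)"
      by (rule norm_cauchy_schwarz)
    finally have "s \<le> norm v / \<delta> * norm (cinner (N x) x - z) + C / \<delta> * t"
      using \<delta> by (simp add: field_simps)
    then show "(norm (x - P z x))\<^sup>2
        \<le> norm v / \<delta> * norm (cinner (N x) x - z) + (C / \<delta> + 1) * (\<Sum>k\<in>\<Lambda> - ?E. (norm (P k x))\<^sup>2)"
      unfolding norm_minus_P split by (simp add: s_def t_def p_def algebra_simps)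
  qed
qed

lemma Lim1_imp_concentration:
  assumes e: "total_orthonormal e"
    and Lim1: "(\<lambda>n. cinner (N (e n)) (e n)) \<in> Lim1 {x. x extreme_point_of (convex hull (essential_spectrum N))}"
  obtains \<xi> where "\<And>n. \<xi> n extreme_point_of (convex hull (essential_spectrum N))"
    "summable (\<lambda>n. (norm (e n - P (\<xi> n) (e n)))\<^sup>2)"
proof -
  let ?E = "essential_spectrum N"
  let ?X = "{x. x extreme_point_of (convex hull ?E)}"
  define d where "d = (\<lambda>n. cinner (N (e n)) (e n))"
  have norm_e: "norm (e n) = 1" for n
    by (rule orthonormal_on_norm[OF total_orthonormalD(1)[OF e]]) simp
  have sub: "?E \<subseteq> \<Lambda>"
    by (rule essential_spectrum_subset[OF e])
  then have finE: "finite ?E"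
    using finite_\<Lambda> by (rule finite_subset)
  have XE: "?X \<subseteq> ?E"
    using extreme_point_of_convex_hull by blast
  have finX: "finite ?X"
    by (rule finite_subset[OF XE finE])
  define t where "t = (\<lambda>n. \<Sum>k\<in>\<Lambda> - ?E. (norm (P k (e n)))\<^sup>2)"
  have summ_t: "summable t"
    unfolding t_def using essential_spectrum_iff[OF e] by (intro summable_sum) auto
  \<comment> \<open>This excludes the default \<open>infdist z {} = 0\<close>: without essential
    values the weights \<open>t n\<close> would all be 1, against their summability.\<close>
  have "?E \<noteq> {}"
  proof
    assume "?E = {}"
    then have "t n = 1" for n
      using norm_square_sum_P[of "e n"] by (simp add: t_def norm_e)
    then have "t = (\<lambda>n. 1)" ..
    with summ_t show False
      by (simp add: summable_const_iff)
  qed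
  moreover have "convex hull ?E = convex hull ?X"
    using finE by (intro Krein_Milman_Minkowski finite_imp_compact_convex_hull convex_convex_hull)
  ultimately have "?X \<noteq> {}"
    by (metis convex_hull_eq_empty)
  have "\<forall>n. \<exists>z\<in>?X. infdist (d n) ?X = dist (d n) z"
    using infdist_attains_inf[OF finite_imp_closed[OF finX] \<open>?X \<noteq> {}\<close>] by blast
  then obtain \<xi> where \<xi>: "\<And>n. \<xi> n \<in> ?X" "\<And>n. infdist (d n) ?X = dist (d n) (\<xi> n)"
    by metis
  have "\<exists>a b. a \<ge> 0 \<and> b \<ge> 0 \<and> (\<forall>x. norm x = 1 \<longrightarrow> (norm (x - P z x))\<^sup>2
       \<le> a * norm (cinner (N x) x - z) + b * (\<Sum>k\<in>\<Lambda> - ?E. (norm (P k x))\<^sup>2))" if "z \<in> ?X" for z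
  proof -
    have "z extreme_point_of (convex hull ?E)"
      using that by simp
    then show ?thesis
      by (rule vertex_concentration[OF sub]) blast
  qed
  then obtain a b where ab: "\<And>z. z \<in> ?X \<Longrightarrow> a z \<ge> 0 \<and> b z \<ge> 0 \<and> (\<forall>x. norm x = 1 \<longrightarrow> (norm (x - P z x))\<^sup>2
       \<le> a z * norm (cinner (N x) x - z) + b z * (\<Sum>k\<in>\<Lambda> - ?E. (norm (P k x))\<^sup>2))"
    by metis
  \<comment> \<open>The separation constants depend on the vertex; summing them over the finitely
    many vertices makes them uniform in \<open>n\<close>.\<close>
  have bound: "(norm (e n - P (\<xi> n) (e n)))\<^sup>2 \<le> sum a ?X * infdist (d n) ?X + sum b ?X * t n" for n
  proof -
    have "(norm (e n - P (\<xi> n) (e n)))\<^sup>2 \<le> a (\<xi> n) * infdist (d n) ?X + b (\<xi> n) * t n"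
      unfolding \<xi>(2) t_def using ab[OF \<xi>(1)[of n]] norm_e[of n] by (simp add: d_def dist_norm)
    also have "\<dots> \<le> sum a ?X * infdist (d n) ?X + sum b ?X * t n"
    proof (intro add_mono mult_right_mono member_le_sum finX \<xi>(1) infdist_nonneg)
      show "0 \<le> t n"
        unfolding t_def by (intro sum_nonneg) simp
    qed (use ab in auto)
    finally show ?thesis .
  qed
  have "summable (\<lambda>n. (norm (e n - P (\<xi> n) (e n)))\<^sup>2)"
  proof (rule summable_comparison_test)
    show "\<exists>m. \<forall>n\<ge>m. norm ((norm (e n - P (\<xi> n) (e n)))\<^sup>2) \<le> sum a ?X * infdist (d n) ?X + sum b ?X * t n"
      using bound by simp
    show "summable (\<lambda>n. sum a ?X * infdist (d n) ?X + sum b ?X * t n)"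
      using Lim1 summ_t by (intro summable_add summable_mult) (simp_all add: Lim1_def d_def)
  qed
  with \<xi>(1) that show thesis
    by blast
qed

text \<open>
  Orthonormalize the eigenvectors \<open>P (\<xi> n) (e n)\<close> for large \<open>n\<close>. The complement of the
  resulting sequence is spanned by eigenvectors as well, and its dimension is
  the number of omitted indices by the lemma \<open>orthonormal_shift_le\<close>, applied in both directions.
\<close>

lemma concentration_imp_diagonalizable:
  assumes e: "total_orthonormal e"
    and summ: "summable (\<lambda>n. (norm (e n - P (\<xi> n) (e n)))\<^sup>2)"
  shows "diagonalizable_by_HS_perturbation e N"
proof -
  note on = total_orthonormalD(1)[OF e]
  define r where "r = (\<lambda>n. (norm (e n - P (\<xi> n) (e n)))\<^sup>2)"
  obtain m where m: "norm (\<Sum>i. r (i + m)) < 1 / 64"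
    using suminf_exist_split[of "1 / 64" r] summ unfolding r_def by fastforce
  define u where "u = (\<lambda>n. e (m + n))"
  define g where "g = (\<lambda>n. P (\<xi> (m + n)) (u n))"
  define W where "W = (\<lambda>n. {x. N x = \<xi> (m + n) *\<^sub>C x})"
  have u: "orthonormal_on UNIV u"
    using on by (simp add: orthonormal_on_def u_def)
  have rg: "(norm (u n - g n))\<^sup>2 = r (n + m)" for n
    by (simp add: r_def u_def g_def add.commute)
  have summ_g: "summable (\<lambda>n. (norm (u n - g n))\<^sup>2)"
    using summ unfolding rg r_def[symmetric] by (simp add: summable_iff_shift)
  have small: "(\<Sum>n. (norm (u n - g n))\<^sup>2) < 1 / 64"
    using m unfolding rg by simp
  have "(\<Sum>k<n. (norm (u k - g k))\<^sup>2) \<le> 1 / 64" for n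
    using sum_le_suminf[OF summ_g, of "{..<n}"] small by simp
  moreover have "cvec.subspace (W n)" for n
    unfolding W_def by (rule cvec.subspaceI)
      (simp_all add: bounded_clinear_zero[OF bounded_N] bounded_clinear_add[OF bounded_N]
        bounded_clinear_scaleC[OF bounded_N] scaleC_add_right scaleC_scaleC mult.commute)
  moreover have "g n \<in> W n" for n
    by (simp add: g_def W_def N_P)
  moreover have "W k = W n \<or> (\<forall>x\<in>W n. \<forall>y\<in>W k. cinner x y = 0)" for k n
  proof (cases "\<xi> (m + k) = \<xi> (m + n)")
    case False
    have "cinner x y = 0" if "x \<in> W n" "y \<in> W k" for x y
    proof -
      have "cinner x y = cinner (P (\<xi> (m + n)) x) y"
        using that(1) by (simp add: W_def P_eigenvector)
      also have "\<dots> = cinner x (P (\<xi> (m + n)) y)"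
        by (rule P_selfadjoint)
      also have "P (\<xi> (m + n)) y = 0"
        using that(2) False by (intro P_eigenvector_other) (auto simp: W_def)
      finally show ?thesis
        by simp
    qed
    then show ?thesis
      by blast
  qed (simp add: W_def)
  moreover have "norm (cinner (g n) (g k)) \<le> norm (cinner (u n - g n) (u k))" if "k \<noteq> n" for k n
  proof (cases "\<xi> (m + k) = \<xi> (m + n)")
    case True
    \<comment> \<open>Both vectors are images under the same orthogonal projection, so it may be
      dropped on one side; then orthogonality of \<open>u n\<close> and \<open>u k\<close> brings in
      the error \<open>u n - g n\<close>.\<close>
    have "cinner (g n) (g k) = cinner (g n) (u k)"
      unfolding g_def True P_selfadjoint[symmetric] P_P by simp
    also have "\<dots> = - cinner (u n - g n) (u k)"
      using that by (simp add: cinner_diff_left orthonormal_onD[OF u])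
    finally show ?thesis
      by simp
  next
    case False
    then have "cinner (g n) (g k) = 0"
      unfolding g_def by (simp add: P_selfadjoint P_P)
    then show ?thesis
      by simp
  qed
  ultimately obtain f where f: "orthonormal_on UNIV f" "\<And>n. f n \<in> W n"
      "\<And>n. norm (f n - u n) \<le> 6 * norm (u n - g n)"
    using gram_schmidt_perturbation[OF u, of W g] by blast
  have fr: "(norm (f n - u n))\<^sup>2 \<le> 36 * (norm (u n - g n))\<^sup>2" for n
    using power_mono[OF f(3)[of n], of 2] by (simp add: power_mult_distrib)
  have summ_f: "summable (\<lambda>n. (norm (f n - u n))\<^sup>2)"
    by (rule summable_comparison_test[OF _ summable_mult[OF summ_g, of 36]]) (use fr in auto)
  have "(\<Sum>n. (norm (f n - u n))\<^sup>2) \<le> (\<Sum>n. 36 * (norm (u n - g n))\<^sup>2)"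
    by (intro suminf_le fr summ_f summable_mult summ_g)
  also have "\<dots> = 36 * (\<Sum>n. (norm (u n - g n))\<^sup>2)"
    by (rule suminf_mult[OF summ_g])
  \<comment> \<open>36/64 < 1 is the smallness that \<open>orthonormal_shift_le\<close> asks
    for.\<close>
  finally have small_f: "(\<Sum>n. (norm (f n - u n))\<^sup>2) < 1"
    using small by simp
  have Pf: "P l (f n) = (if l = \<xi> (m + n) then f n else 0)" for l n
  proof -
    have "N (f n) = \<xi> (m + n) *\<^sub>C f n"
      using f(2)[of n] by (simp add: W_def)
    from P_eigenvector[OF this] P_eigenvector_other[OF this, of l] show ?thesis
      by simp
  qed
  \<comment> \<open>Only eigenvectors are collected, so a maximal orthonormal family in
    \<open>V\<close> completes \<open>f\<close> to an eigenbasis.\<close>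
  define V where "V = {x. (\<exists>l. N x = l *\<^sub>C x) \<and> (\<forall>n. cinner x (f n) = 0)}"
  have prepend: "\<exists>h. orthonormal_on UNIV h \<and> h ` {..<card B} = B \<and> (\<forall>j. h (card B + j) = f j)"
    if B: "finite B" "B \<subseteq> V" "orthonormal_on B (\<lambda>x. x)" for B
  proof -
    have "cinner b (f j) = 0" if "b \<in> B" for b j
      using that B(2) by (auto simp: V_def)
    then show ?thesis
      by (rule orthonormal_prepend[OF B(1,3) f(1)]) blast+
  qed
  have card_le: "card B \<le> m" if B: "finite B" "B \<subseteq> V" "orthonormal_on B (\<lambda>x. x)" for B
  proof -
    obtain h where h: "orthonormal_on UNIV h" "\<And>j. h (card B + j) = f j"
      using prepend[OF B] by blast
    show ?thesis
      by (rule orthonormal_shift_le[OF e h(1)])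
         (use summ_f small_f in \<open>simp_all add: h(2) u_def\<close>)
  qed
  have scale: "c *\<^sub>C x \<in> V" if x: "x \<in> V" for c x
  proof -
    obtain l where "N x = l *\<^sub>C x"
      using x by (auto simp: V_def)
    then have "N (c *\<^sub>C x) = l *\<^sub>C c *\<^sub>C x"
      by (simp add: bounded_clinear_scaleC[OF bounded_N] scaleC_scaleC mult.commute)
    with x show ?thesis
      by (auto simp: V_def cinner_scaleC_left)
  qed
  obtain B where B: "finite B" "B \<subseteq> V" "orthonormal_on B (\<lambda>x. x)"
      "\<forall>x\<in>V. (\<forall>b\<in>B. cinner x b = 0) \<longrightarrow> x = 0"
    by (rule maximal_orthonormal[OF card_le scale])
  obtain h where h: "orthonormal_on UNIV h" "h ` {..<card B} = B" "\<And>j. h (card B + j) = f j"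
    using prepend[OF B(1-3)] by blast
  have "x = 0" if x: "\<And>n. cinner x (h n) = 0" for x
  proof -
    have xf: "cinner x (f j) = 0" for j
      using x[of "card B + j"] h(3) by simp
    have xb: "cinner x b = 0" if b: "b \<in> B" for b
    proof -
      have "b \<in> h ` {..<card B}"
        by (simp only: h(2) b)
      then obtain i where "b = h i"
        by blast
      then show ?thesis
        by (simp only: x)
    qed
    \<comment> \<open>Maximality of \<open>B\<close> speaks about eigenvectors only, so
      \<open>x\<close> is tested through its spectral components. Each \<open>P l\<close> fixes or
      kills every \<open>f j\<close> and every \<open>b\<close>, and thus preserves orthogonality to
      them.\<close>
    have "P l x = 0" for l
    proof -
      have "cinner (P l x) (f j) = 0" for j
        unfolding P_selfadjoint Pf by (simp add: xf)
      then have "P l x \<in> V"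
        unfolding V_def using N_P[of l x] by blast
      moreover have "cinner (P l x) b = 0" if b: "b \<in> B" for b
      proof -
        obtain k where "N b = k *\<^sub>C b"
          using b B(2) by (auto simp: V_def)
        then have "P l b = (if l = k then b else 0)"
          using P_eigenvector[of b k] P_eigenvector_other[of b k l] by (cases "l = k") simp_all
        then show ?thesis
          by (simp add: P_selfadjoint xb[OF b])
      qed
      ultimately show ?thesis
        using B(4) by blast
    qed
    then show ?thesis
      using sum_P[of x] by simp
  qed
  with h(1) have total: "total_orthonormal h"
    by (simp add: total_orthonormal_def)
  \<comment> \<open>Now the roles are exchanged: the completed system \<open>h\<close> is total, so
    \<open>e\<close> can be compared against it.\<close>
  have "m \<le> card B"
  proof (rule orthonormal_shift_le[OF total on])
    have "(norm (e (m + j) - h (card B + j)))\<^sup>2 = (norm (f j - u j))\<^sup>2" for j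
      by (simp add: h(3) u_def norm_minus_commute)
    then show "summable (\<lambda>j. (norm (e (m + j) - h (card B + j)))\<^sup>2)"
        "(\<Sum>j. (norm (e (m + j) - h (card B + j)))\<^sup>2) < 1"
      using summ_f small_f by simp_all
  qed
  with card_le[OF B(1-3)] have cB: "card B = m"
    by simp
  show ?thesis
  proof (rule diagonalizable_by_eigenbasis[OF bounded_N e total])
    show "\<exists>l. N (h n) = l *\<^sub>C h n" for n
    proof (cases "n < card B")
      case True
      then have "h n \<in> h ` {..<card B}"
        by (intro imageI) simp
      then have "h n \<in> B"
        by (simp only: h(2))
      then have "h n \<in> V"
        using B(2) by blast
      then show ?thesis
        by (simp add: V_def)
    next
      case False
      then have "h n = f (n - card B)"
        using h(3)[of "n - card B"] by simp
      then show ?thesis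
        using f(2)[of "n - card B"] by (auto simp: W_def)
    qed
    \<comment> \<open>Equality of the two counts aligns the indices: \<open>h (m + j)\<close> is
      \<open>f j\<close>, which is close to \<open>u j\<close>, that is
      \<open>e (m + j)\<close>.\<close>
    have "summable (\<lambda>n. (norm (h (n + m) - e (n + m)))\<^sup>2)"
      using summ_f h(3) by (simp add: cB u_def add.commute)
    then show "summable (\<lambda>n. (norm (h n - e n))\<^sup>2)"
      using summable_iff_shift[of "\<lambda>n. (norm (h n - e n))\<^sup>2" m] by simp
  qed
qed

end

theorem theorem4p2:
  fixes e :: "nat \<Rightarrow> 'a::chilbert_space"
    and N :: "'a \<Rightarrow> 'a"
    and d :: "nat \<Rightarrow> complex"
    and X :: "complex set"
  assumes "orthonormal_basis e"
    and "normal_op N"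
    and "finite (op_spectrum N)"
    and "d = (\<lambda>n. cinner (N (e n)) (e n))"
    and "X = {x. x extreme_point_of (convex hull (essential_spectrum N))}"
  shows "d \<in> Lim1 X \<longleftrightarrow>
    essential_spectrum N = X \<and> diagonalizable_by_HS_perturbation e N"
proof -
  have e: "total_orthonormal e"
    by (rule orthonormal_basis_total[OF assms(1)])
  have N: "bounded_clinear N"
    using assms(2) by (simp add: normal_op_def)
  have A: "is_adjoint N (cadjoint N)"
    by (rule is_adjoint_cadjoint[OF e N])
  have comm: "N (cadjoint N x) = cadjoint N (N x)" for x
    using assms(2) by (simp add: normal_op_def fun_eq_iff)
  obtain P where "spectral_resolution N (insert 0 (op_spectrum N)) P"
    by (rule normal_spectral_resolution[OF N A comm assms(3)])
  then interpret spectral_resolution N "insert 0 (op_spectrum N)" P .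
  show ?thesis
  proof
    assume "d \<in> Lim1 X"
    then have "(\<lambda>n. cinner (N (e n)) (e n)) \<in> Lim1 {x. x extreme_point_of (convex hull (essential_spectrum N))}"
      by (simp only: assms(4,5))
    then obtain \<xi> where "\<And>n. \<xi> n extreme_point_of (convex hull (essential_spectrum N))"
      and summ: "summable (\<lambda>n. (norm (e n - P (\<xi> n) (e n)))\<^sup>2)"
      by (rule Lim1_imp_concentration[OF e]) blast
    then have \<xi>: "\<xi> n \<in> X" for n
      by (simp add: assms(5))
    have "l \<in> X" if l: "l \<in> essential_spectrum N" for l
    proof (rule ccontr)
      assume "l \<notin> X"
      \<comment> \<open>As \<open>l\<close> differs from the vertex \<open>\<xi> n\<close>,
        \<open>P l\<close> sees only the part of \<open>e n\<close> outside the eigenspace of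
        \<open>\<xi> n\<close>; summability then makes \<open>l\<close> inessential.\<close>
      have "norm (P l (e n)) \<le> norm (e n - P (\<xi> n) (e n))" for n
      proof -
        have "P l (e n) = P l (e n - P (\<xi> n) (e n))"
          using \<open>l \<notin> X\<close> \<xi>[of n] by (auto simp: bounded_clinear_diff[OF bounded_P] P_P)
        then show ?thesis
          using norm_P_le[of l "e n - P (\<xi> n) (e n)"] by simp
      qed
      then have "summable (\<lambda>n. (norm (P l (e n)))\<^sup>2)"
        by (intro summable_comparison_test[OF _ summ]) (auto intro: power_mono)
      with l show False
        by (simp add: essential_spectrum_iff[OF e])
    qed
    moreover have "X \<subseteq> essential_spectrum N"
      unfolding assms(5) using extreme_point_of_convex_hull by blast
    ultimately show "essential_spectrum N = X \<and> diagonalizable_by_HS_perturbation e N"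
      using concentration_imp_diagonalizable[OF e summ] by blast
  next
    assume "essential_spectrum N = X \<and> diagonalizable_by_HS_perturbation e N"
    \<comment> \<open>The eigenbasis argument controls the distance to the whole essential spectrum,
      which is \<open>X\<close> here.\<close>
    then show "d \<in> Lim1 X"
      using diagonalizable_imp_Lim1[OF e N A comm assms(3)] assms(4) by simp
  qed
qed

end
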